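(* Let $\{Z_t\}_{t\in\mathbb Z}$ be a stationary real-valued time series which is 2-mixing with size $\mathfrak v$, with marginal density $f$. Suppose: (i) $f$ is uniformly bounded; (ii) with $f^{(t,\tau)}$ the joint density of $(Z_t,Z_\tau)$ and $F^{(t,\tau)}(x,y):=f^{(t,\tau)}(x,y)-f(x)f(y)$ for $t\neq\tau$, the norms $\|F^{(0,t)}\|_{p_F}$ are bounded uniformly in $t$ for some $p_F>2$, and $q_F:=1-2/p_F\in(0,1)$; (iii) $K:\mathbb R\to\mathbb R$ is a univariate kernel of order $r$ which is uniformly bounded with $\|K\|_1<\infty$ and $\|K\|_2<\infty$; (iv) $f\in\mathfrak G^1_{s,\triangle}$ for some $\triangle,s>0$, and $r\ge s$. Define $$\gamma:=\begin{cases}1,&\mathfrak v>1+1/q_F;\\ [\mathfrak v\wedge1]\cdot\dfrac{2s+1}{2s+(2+q_F(1-[\mathfrak v\vee1]))},&\mathfrak v\le 1+1/q_F,\end{cases}$$ and let $\hat f(z)=\frac1T\sum_{t=1}^TK_{b^*}(Z_t-z)$ with bandwidth $b^*\approx T^{-\gamma/(2s+1)}$. Then for all $z\in\mathbb R$, $$\mathbb E|\hat f(z)-f(z)|^2=O\bigl(T^{-\frac{2s}{2s+1}\gamma}\bigr),\qquad T\to\infty.$$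
   Context: $\wedge$ is minimum, $\vee$ is maximum; $a_T\approx c_T$ means the ratio is bounded above and below by positive constants. For $b>0$, $K_b(z)=b^{-1}K(z/b)$. $\|g\|_p=(\int|g|^p)^{1/p}$. All densities mentioned are assumed to exist. 2-mixing: $\{Z_t\}$ is 2-mixing with size $\mathfrak v$ if there is $C<\infty$ such that for all $t\ne\tau$, $\sup_{A\in\sigma(Z_t),B\in\sigma(Z_\tau)}|P(A\cap B)-P(A)P(B)|\le C|t-\tau|^{-\mathfrak v}$. Kernel of order $r$ (univariate): $K$ is an even function with $\int K(u)\,du=1$, $\int u^iK(u)\,du=0$ for $i=1,\dots,r-1$, and $\int|u|^rK(u)\,du=S_K$ for a (finite) constant $S_K$. Class $\mathfrak G^d_{s,\triangle}$ ($s,\triangle>0$): functions $g:\mathbb R^d\to\mathbb R$ that are everywhere $(m-1)$-times partially differentiable, where $m$ is the integer with $m-1<s\le m$, and such that for some $\varrho>0$ and for all $x$, $\sup_{y:|y-x|<\varrho}\frac{|g(y)-g(x)-Q(y-x)|}{|y-x|^s}\le\triangle$, where $Q=0$ if $m=1$ and, for $m>1$, $Q$ is the $(m-1)$th-degree (Taylor) polynomial in $y-x$ without constant term whose coefficients are given by the partial derivatives of $g$ of orders $1$ to $m-1$ at $x$.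
   Formalization: The mixing size 𝔳 = 1 is excluded: at exactly that value the stated rate can fail by a factor log T, since the mixing covariance bounds sum 1/t over t ≤ T and can be attained; every other 𝔳 is covered as stated. *)

theory Defs
  imports "HOL-Probability.Probability" "HOL-Library.Landau_Symbols"
begin

text \<open>Strict stationarity, as shift invariance of the law of the whole process.\<close>

definition stationary_process :: "'w measure \<Rightarrow> (int \<Rightarrow> 'w \<Rightarrow> real) \<Rightarrow> bool" where
  "stationary_process M Z \<longleftrightarrow>
     (\<forall>t. Z t \<in> borel_measurable M) \<and>
     (\<forall>h. distr M (Pi\<^sub>M UNIV (\<lambda>_. borel)) (\<lambda>\<omega> t. Z (t + h) \<omega>) =
          distr M (Pi\<^sub>M UNIV (\<lambda>_. borel)) (\<lambda>\<omega> t. Z t \<omega>))"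

definition generated_sigma :: "'w measure \<Rightarrow> ('w \<Rightarrow> real) \<Rightarrow> 'w set set" where
  "generated_sigma M X = sets (vimage_algebra (space M) X borel)"

definition two_mixing :: "'w measure \<Rightarrow> (int \<Rightarrow> 'w \<Rightarrow> real) \<Rightarrow> real \<Rightarrow> bool" where
  "two_mixing M Z v \<longleftrightarrow>
     (\<exists>C::real. \<forall>t u. t \<noteq> u \<longrightarrow>
        (SUP (A, B) \<in> generated_sigma M (Z t) \<times> generated_sigma M (Z u).
           \<bar>measure M (A \<inter> B) - measure M A * measure M B\<bar>)
        \<le> C * real_of_int \<bar>t - u\<bar> powr (- v))"

text \<open>\<open>Lp_norm\<close> is the norm only for members of \<open>Lp_space\<close>: the Bochner integral of a
  non-integrable function is 0.\<close>

definition Lp_space :: "'a measure \<Rightarrow> real \<Rightarrow> ('a \<Rightarrow> real) set" where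
  "Lp_space M p = {g \<in> borel_measurable M. integrable M (\<lambda>x. \<bar>g x\<bar> powr p)}"

definition Lp_norm :: "'a measure \<Rightarrow> real \<Rightarrow> ('a \<Rightarrow> real) \<Rightarrow> real" where
  "Lp_norm M p g = (LINT x|M. \<bar>g x\<bar> powr p) powr (1 / p)"

text \<open>The moments are required to exist as absolutely convergent integrals.\<close>

definition kernel_of_order :: "nat \<Rightarrow> (real \<Rightarrow> real) \<Rightarrow> bool" where
  "kernel_of_order r K \<longleftrightarrow>
     (\<forall>u. K (- u) = K u) \<and>
     has_bochner_integral lborel K 1 \<and>
     (\<forall>i\<in>{1..<r}. has_bochner_integral lborel (\<lambda>u. u ^ i * K u) 0) \<and>
     (\<exists>S. has_bochner_integral lborel (\<lambda>u. \<bar>u\<bar> ^ r * K u) S)"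

text \<open>The univariate smoothness class; for \<open>m = 1\<close> the sum is empty.\<close>

definition smooth_class :: "real \<Rightarrow> real \<Rightarrow> (real \<Rightarrow> real) set" where
  "smooth_class s \<Delta> = {g. \<exists>m::nat. real m - 1 < s \<and> s \<le> real m \<and>
     (\<forall>k<m - 1. \<forall>x. (deriv ^^ k) g differentiable (at x)) \<and>
     (\<exists>\<rho>>0. \<forall>x y. y \<noteq> x \<and> \<bar>y - x\<bar> < \<rho> \<longrightarrow>
        \<bar>g y - g x - (\<Sum>k=1..m - 1. (deriv ^^ k) g x / fact k * (y - x) ^ k)\<bar>
          / \<bar>y - x\<bar> powr s \<le> \<Delta>)}"

definition scaled_kernel :: "(real \<Rightarrow> real) \<Rightarrow> real \<Rightarrow> real \<Rightarrow> real" where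
  "scaled_kernel K b z = K (z / b) / b"

definition kernel_estimator ::
  "(real \<Rightarrow> real) \<Rightarrow> (nat \<Rightarrow> real) \<Rightarrow> (int \<Rightarrow> 'w \<Rightarrow> real) \<Rightarrow> nat \<Rightarrow> real \<Rightarrow> 'w \<Rightarrow> real" where
  "kernel_estimator K b Z T z \<omega> =
     (\<Sum>t=1..T. scaled_kernel K (b T) (Z (int t) \<omega> - z)) / real T"

text \<open>At \<open>v = 1\<close> this exponent is too large by a logarithmic factor in the resulting rate:
  there the covariance bound sums \<open>1 / t\<close> over \<open>t \<le> T\<close>, and that bound can be attained.
  The rate holds for every other \<open>v\<close>.\<close>

definition rate_exponent :: "real \<Rightarrow> real \<Rightarrow> real \<Rightarrow> real" where
  "rate_exponent v q s =
     (if v > 1 + 1 / q then 1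
      else min v 1 * ((2 * s + 1) / (2 * s + (2 + q * (1 - max v 1)))))"

end

theory Submission
  imports Defs
begin

text \<open>
The mean squared error is at most twice the variance plus twice the squared bias. The bias is of
order \<open>b powr s\<close> (\<open>kernel_bias_le\<close>): the moments of \<open>K\<close> annihilate the Taylor polynomial of \<open>f\<close> at
\<open>z\<close>, and the remainder is bounded globally since \<open>f\<close> is bounded.

The variance of the average is at most \<open>1 / T\<close> times the variance of one kernel term, of order
\<open>1 / b\<close>, plus \<open>2 / T\<close> times the sum over lags \<open>k \<le> T\<close> of a bound for the covariance at lag \<open>k\<close>. Two bounds
compete (\<open>kernel_covariance_le\<close>). Mixing gives \<open>b powr (- 2) * k powr (- v)\<close>, which decays with the lag but
has a bad power of \<open>b\<close>; it comes from a layer-cake argument for bounded variables. Hoelder's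
inequality for \<open>F\<close> gives \<open>b powr (q - 1)\<close> with \<open>q = 1 - 2 / p\<close>, which has a good power of \<open>b\<close>
but no decay.

For \<open>v < 1\<close> the mixing bound alone, summed over \<open>k \<le> T\<close>, gives variance of order
\<open>b powr (- 2) * T powr (- v)\<close>. For \<open>v > 1\<close> the bound without decay is used up to the lag \<open>b powr (- q)\<close> and
the mixing bound beyond it. This gives variance of order
\<open>(b powr (- 1) + b powr (- (2 + q (1 - v)))) / T\<close>; the first term dominates exactly when \<open>v\<close> is above
\<open>1 + 1 / q\<close>. In each case \<open>\<gamma>\<close> is the exponent for which the dominant variance term
is of the order \<open>b powr (2 * s)\<close> of the squared bias (\<open>rate_of_mse_bound\<close>).
\<close>

section \<open>Sums of powers\<close>
text \<open>The difference on the right telescopes, so this single bound serves both as the integral test for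
the tail of a convergent series (\<open>v > 1\<close>) and for the growth of a divergent one (\<open>v < 1\<close>, negative
\<open>v\<close> included). By the mean value theorem the difference is \<open>(1 - v) \<xi> powr (- v)\<close> with \<open>\<xi>\<close> between \<open>k\<close>
and \<open>k + 1 \<le> 2 k\<close>, and moving from \<open>k\<close> to \<open>\<xi>\<close> costs at most the factor \<open>2 powr \<bar>v\<bar>\<close>.\<close>
lemma powr_le_difference:
  fixes k :: nat and v :: real
  assumes "1 \<le> k" "v \<noteq> 1"
  shows "real k powr (- v) \<le> 2 powr \<bar>v\<bar> / (1 - v) * (real (Suc k) powr (1 - v) - real k powr (1 - v))"
proof -
  have "\<exists>\<xi>. real k < \<xi> \<and> \<xi> < real (Suc k) \<and>
      real (Suc k) powr (1 - v) - real k powr (1 - v) = (real (Suc k) - real k) * ((1 - v) * \<xi> powr (- v))"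
  proof (rule MVT2)
    show "real k < real (Suc k)" by simp
    fix x assume "real k \<le> x" "x \<le> real (Suc k)"
    then have "0 < x" using assms by linarith
    then show "((\<lambda>x. x powr (1 - v)) has_real_derivative (1 - v) * x powr (- v)) (at x)"
      using has_real_derivative_powr[of x "1 - v"] by simp
  qed
  then obtain \<xi> where x: "real k < \<xi>" "\<xi> < real (Suc k)"
    and eq: "real (Suc k) powr (1 - v) - real k powr (1 - v) = (1 - v) * \<xi> powr (- v)" by auto
  have pos: "0 < real k" "0 < \<xi>" using assms x by auto
  have "(real k / \<xi>) powr (- v) \<le> 2 powr \<bar>v\<bar>"
  proof -
    have r: "1/2 \<le> real k / \<xi>" "real k / \<xi> \<le> 1"
      using x pos assms by (auto simp: field_simps)
    show ?thesis
    proof (cases "v \<ge> 0")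
      case True
      have "(real k / \<xi>) powr (- v) \<le> (1/2) powr (- v)"
        using r True by (intro powr_mono2') auto
      also have "\<dots> = 2 powr \<bar>v\<bar>" using True by (simp add: powr_divide powr_minus)
      finally show ?thesis .
    next
      case False
      have "(real k / \<xi>) powr (- v) \<le> 1 powr (- v)"
        using r False pos by (intro powr_mono2) auto
      also have "\<dots> \<le> 2 powr \<bar>v\<bar>" by (simp add: ge_one_powr_ge_zero)
      finally show ?thesis .
    qed
  qed
  then have "real k powr (- v) \<le> 2 powr \<bar>v\<bar> * \<xi> powr (- v)"
    using pos by (simp add: powr_divide field_simps)
  then show ?thesis unfolding eq using assms by simp
qed

lemma sum_powr_atLeastAtMost_le:
  fixes N T :: nat and v :: real
  assumes "1 \<le> N" "N \<le> T" "v \<noteq> 1"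
  shows "(\<Sum>k=N..T. real k powr (- v))
    \<le> 2 powr \<bar>v\<bar> / (1 - v) * (real (Suc T) powr (1 - v) - real N powr (1 - v))"
proof -
  have "(\<Sum>k=N..T. real k powr (- v))
     \<le> (\<Sum>k=N..T. 2 powr \<bar>v\<bar> / (1 - v) * (real (Suc k) powr (1 - v) - real k powr (1 - v)))"
    using assms by (intro sum_mono powr_le_difference) auto
  also have "\<dots> = 2 powr \<bar>v\<bar> / (1 - v) * (real (Suc T) powr (1 - v) - real N powr (1 - v))"
    unfolding sum_distrib_left[symmetric]
    using assms sum_Suc_diff[of N "T" "\<lambda>k. real k powr (1 - v)"] by simp
  finally show ?thesis .
qed

lemma sum_powr_le_of_lt_one:
  fixes v :: real
  assumes "v < 1" "1 \<le> T"
  shows "(\<Sum>k=1..T. real k powr (- v)) \<le> 2 powr \<bar>v\<bar> * 2 powr (1 - v) / (1 - v) * real T powr (1 - v)"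
proof -
  have "(\<Sum>k=1..T. real k powr (- v)) \<le> 2 powr \<bar>v\<bar> / (1 - v) * (real (Suc T) powr (1 - v) - real 1 powr (1 - v))"
    using assms by (intro sum_powr_atLeastAtMost_le) auto
  also have "\<dots> \<le> 2 powr \<bar>v\<bar> / (1 - v) * ((2 * real T) powr (1 - v))"
  proof (rule mult_left_mono)
    have "real (Suc T) powr (1 - v) \<le> (2 * real T) powr (1 - v)"
      using assms by (intro powr_mono2) auto
    then show "real (Suc T) powr (1 - v) - real 1 powr (1 - v) \<le> (2 * real T) powr (1 - v)" by simp
  qed (use assms in simp)
  also have "\<dots> = 2 powr \<bar>v\<bar> * 2 powr (1 - v) / (1 - v) * real T powr (1 - v)"
    by (simp add: powr_mult)
  finally show ?thesis .
qed

text \<open>Below the cut-off \<open>x\<close> the constant branch of the minimum is used, above it the decaying one.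
Cutting at the ceiling of \<open>x\<close>, which is at least 1, makes the bound valid for every positive
\<open>x\<close>, however small, and hence later for every bandwidth.\<close>
lemma sum_min_powr_le_of_gt_one:
  fixes v x A B :: real
  assumes "1 < v" "0 < x" "0 \<le> A" "0 \<le> B"
  shows "(\<Sum>k=1..T. min A (B * real k powr (- v)))
    \<le> x * A + 2 powr v / (v - 1) * (B * x powr (1 - v))"
proof -
  define N where "N = nat \<lceil>x\<rceil>"
  have N: "1 \<le> N" "x \<le> real N" "real (N - 1) \<le> x"
    using assms unfolding N_def by linarith+
  have head: "(\<Sum>k\<in>{1..<N}. min A (B * real k powr (- v))) \<le> x * A"
  proof -
    have "(\<Sum>k\<in>{1..<N}. min A (B * real k powr (- v))) \<le> (\<Sum>k\<in>{1..<N}. A)"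
      by (intro sum_mono) simp
    also have "\<dots> = real (N - 1) * A" by simp
    also have "\<dots> \<le> x * A" using N assms by (intro mult_right_mono) auto
    finally show ?thesis .
  qed
  have tail: "(\<Sum>k=N..T. min A (B * real k powr (- v))) \<le> 2 powr v / (v - 1) * (B * x powr (1 - v))"
  proof (cases "N \<le> T")
    case True
    have "(\<Sum>k=N..T. min A (B * real k powr (- v))) \<le> B * (\<Sum>k=N..T. real k powr (- v))"
      unfolding sum_distrib_left by (intro sum_mono) simp
    also have "\<dots> \<le> B * (2 powr \<bar>v\<bar> / (1 - v) * (real (Suc T) powr (1 - v) - real N powr (1 - v)))"
      using assms N True by (intro mult_left_mono sum_powr_atLeastAtMost_le) auto
    also have "\<dots> = B * (2 powr v / (v - 1) * (real N powr (1 - v) - real (Suc T) powr (1 - v)))"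
      using assms by (simp add: divide_simps) (simp add: algebra_simps)
    also have "\<dots> \<le> B * (2 powr v / (v - 1) * (x powr (1 - v)))"
    proof (intro mult_left_mono)
      have "real N powr (1 - v) \<le> x powr (1 - v)"
        using assms N by (intro powr_mono2') auto
      then show "real N powr (1 - v) - real (Suc T) powr (1 - v) \<le> x powr (1 - v)"
        using powr_ge_zero[of "real (Suc T)" "1 - v"] by linarith
    qed (use assms in auto)
    finally show ?thesis by (simp add: mult_ac)
  qed (use assms in simp)
  have "(\<Sum>k=1..T. min A (B * real k powr (- v))) \<le> (\<Sum>k\<in>{1..<N} \<union> {N..T}. min A (B * real k powr (- v)))"
    using assms by (intro sum_mono2) auto
  also have "\<dots> = (\<Sum>k\<in>{1..<N}. min A (B * real k powr (- v))) + (\<Sum>k=N..T. min A (B * real k powr (- v)))"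
    by (intro sum.union_disjoint) auto
  finally show ?thesis using head tail by linarith
qed

section \<open>Covariances of bounded variables under mixing\<close>
lemma (in pair_sigma_finite) has_bochner_integral_mult:
  fixes f g :: "_ \<Rightarrow> real"
  assumes f: "integrable M1 f" and g: "integrable M2 g"
  shows "has_bochner_integral (M1 \<Otimes>\<^sub>M M2) (\<lambda>(x, y). f x * g y)
    (integral\<^sup>L M1 f * integral\<^sup>L M2 g)"
proof -
  have [measurable]: "f \<in> borel_measurable M1" "g \<in> borel_measurable M2" using f g by auto
  have i: "integrable (M1 \<Otimes>\<^sub>M M2) (\<lambda>(x, y). f x * g y)"
  proof (rule Fubini_integrable)
    show "integrable M1 (\<lambda>x. \<integral>y. norm (case (x, y) of (x, y) \<Rightarrow> f x * g y) \<partial>M2)"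
      using f by (simp add: abs_mult)
  qed (use g in auto)
  show ?thesis
    using i integral_fst'[OF i] by (auto simp: has_bochner_integral_iff)
qed

text \<open>Layer-cake representation: \<open>X\<close> is the integral over \<open>x\<close> in \<open>[0, c]\<close> of the indicators of its
superlevel sets, so by Fubini the integral of \<open>X W\<close> is the integral over \<open>[0, c]\<close> of the
quantities bounded by \<open>a\<close>. The weight \<open>W\<close> may change sign.\<close>
lemma abs_integral_mult_le_of_superlevel_sets:
  fixes X W :: "'w \<Rightarrow> real"
  assumes "prob_space M"
    and [measurable]: "X \<in> borel_measurable M" and W: "integrable M W"
    and X: "\<And>\<omega>. 0 \<le> X \<omega>" "\<And>\<omega>. X \<omega> \<le> c"
    and le: "\<And>x. \<bar>LINT \<omega>|M. indicator {\<omega>. x < X \<omega>} \<omega> * W \<omega>\<bar> \<le> a"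
  shows "\<bar>LINT \<omega>|M. X \<omega> * W \<omega>\<bar> \<le> c * a"
proof -
  interpret prob_space M by fact
  interpret P: pair_sigma_finite M lborel ..
  have [measurable]: "W \<in> borel_measurable M" using W by auto
  have c: "0 \<le> c" using X order_trans by blast
  let ?g = "\<lambda>\<omega> x. indicator {0..c} x * (indicator {\<omega>. x < X \<omega>} \<omega> * W \<omega>)"
  have "integrable (M \<Otimes>\<^sub>M lborel) (\<lambda>(\<omega>, x). W \<omega> * indicator {0..c} x)"
    using P.has_bochner_integral_mult[OF W, of "indicator {0..c}"] c
    by (auto simp: has_bochner_integral_iff)
  then have int: "integrable (M \<Otimes>\<^sub>M lborel) (\<lambda>(\<omega>, x). ?g \<omega> x)"
    by (rule Bochner_Integration.integrable_bound)
       (auto simp: indicator_def split: prod.splits)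
  have layer: "(LBINT x. ?g \<omega> x) = X \<omega> * W \<omega>" for \<omega>
  proof -
    have "(LBINT x. ?g \<omega> x) = (LBINT x. indicator {0..<X \<omega>} x * W \<omega>)"
      using X[of \<omega>] by (intro Bochner_Integration.integral_cong) (auto simp: indicator_def)
    then show ?thesis using X[of \<omega>] by simp
  qed
  have "(LINT \<omega>|M. X \<omega> * W \<omega>) = (LINT \<omega>|M. (LBINT x. ?g \<omega> x))"
    by (simp add: layer)
  also have "\<dots> = (LBINT x. (LINT \<omega>|M. ?g \<omega> x))"
    by (rule P.Fubini_integral[OF int, symmetric])
  also have "\<dots> = (LBINT x. indicator {0..c} x * (LINT \<omega>|M. indicator {\<omega>. x < X \<omega>} \<omega> * W \<omega>))"
    by simp
  also have "\<bar>\<dots>\<bar> \<le> (LBINT x. indicator {0..c} x * a)"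
  proof (rule order_trans[OF integral_abs_bound], rule integral_mono)
    show "integrable lborel (\<lambda>x. \<bar>indicator {0..c} x * (LINT \<omega>|M. indicator {\<omega>. x < X \<omega>} \<omega> * W \<omega>)\<bar>)"
      using P.integrable_snd[OF int] by simp
    show "integrable lborel (\<lambda>x. indicator {0..c} x * a)" using c by auto
  qed (use le in \<open>auto simp: indicator_def\<close>)
  also have "\<dots> = c * a" using c by simp
  finally show ?thesis .
qed

text \<open>The strong-mixing covariance inequality. After a shift both variables lie in \<open>[0, 2 c]\<close>. The
layer-cake lemma is then used twice: first to pass from indicators of superlevel sets of \<open>Y\<close> to
\<open>Y\<close> itself, with \<open>X\<close> still represented by an indicator, and then from that indicator to \<open>X\<close>.\<close>
lemma abs_covariance_le_of_superlevel_sets: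
  fixes X Y :: "'w \<Rightarrow> real"
  assumes "prob_space M"
    and X[measurable]: "X \<in> borel_measurable M" and Y[measurable]: "Y \<in> borel_measurable M"
    and bX: "\<And>\<omega>. \<bar>X \<omega>\<bar> \<le> c" and bY: "\<And>\<omega>. \<bar>Y \<omega>\<bar> \<le> c"
    and le: "\<And>x y. \<bar>measure M ({\<omega> \<in> space M. x < X \<omega>} \<inter> {\<omega> \<in> space M. y < Y \<omega>})
      - measure M {\<omega> \<in> space M. x < X \<omega>} * measure M {\<omega> \<in> space M. y < Y \<omega>}\<bar> \<le> a"
  shows "\<bar>(LINT \<omega>|M. X \<omega> * Y \<omega>) - (LINT \<omega>|M. X \<omega>) * (LINT \<omega>|M. Y \<omega>)\<bar> \<le> 4 * c\<^sup>2 * a"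
proof -
  interpret prob_space M by fact
  define U V where "U \<omega> = X \<omega> + c" and "V \<omega> = Y \<omega> + c" for \<omega>
  have [measurable]: "U \<in> borel_measurable M" "V \<in> borel_measurable M"
    unfolding U_def V_def by auto
  have iX: "integrable M X" and iY: "integrable M Y"
    using bX bY by (auto intro!: integrable_const_bound[where B=c])
  have iXY: "integrable M (\<lambda>\<omega>. X \<omega> * Y \<omega>)"
    using bX bY by (intro integrable_const_bound[where B="c*c"]) (auto simp: abs_mult intro!: mult_mono order_trans[OF abs_ge_zero])
  have iU: "integrable M U" and iV: "integrable M V" using iX iY unfolding U_def V_def by auto
  have bU: "0 \<le> U \<omega>" "U \<omega> \<le> 2 * c" and bV: "0 \<le> V \<omega>" "V \<omega> \<le> 2 * c" for \<omega>
    using bX[of \<omega>] bY[of \<omega>] by (auto simp: U_def V_def)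
  define A where "A x = {\<omega> \<in> space M. x < U \<omega>}" for x
  define B where "B y = {\<omega> \<in> space M. y < V \<omega>}" for y
  have [measurable]: "A x \<in> sets M" "B y \<in> sets M" for x y unfolding A_def B_def by auto
  have mix: "\<bar>measure M (A x \<inter> B y) - measure M (A x) * measure M (B y)\<bar> \<le> a" for x y
    using le[of "x - c" "y - c"] by (simp add: A_def B_def U_def V_def algebra_simps)
  have one: "\<bar>LINT \<omega>|M. V \<omega> * (indicator (A x) \<omega> - measure M (A x))\<bar> \<le> (2 * c) * a" for x
  proof (rule abs_integral_mult_le_of_superlevel_sets[OF assms(1)])
    fix y
    have "(LINT \<omega>|M. indicator {\<omega>. y < V \<omega>} \<omega> * (indicator (A x) \<omega> - measure M (A x)))
        = (LINT \<omega>|M. indicator (A x \<inter> B y) \<omega> - measure M (A x) * indicator (B y) \<omega>)"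
      by (intro Bochner_Integration.integral_cong) (auto simp: B_def indicator_def)
    also have "\<dots> = measure M (A x \<inter> B y) - measure M (A x) * measure M (B y)"
      by (subst Bochner_Integration.integral_diff) (auto simp: emeasure_eq_measure)
    finally show "\<bar>LINT \<omega>|M. indicator {\<omega>. y < V \<omega>} \<omega> * (indicator (A x) \<omega> - measure M (A x))\<bar> \<le> a"
      using mix[of x y] by simp
  qed (use bV in \<open>auto simp: emeasure_eq_measure\<close>)
  have "\<bar>LINT \<omega>|M. U \<omega> * (V \<omega> - expectation V)\<bar> \<le> (2 * c) * ((2 * c) * a)"
  proof (rule abs_integral_mult_le_of_superlevel_sets[OF assms(1)])
    fix x
    have iVA: "integrable M (\<lambda>\<omega>. V \<omega> * indicator (A x) \<omega>)"
      using integrable_mult_indicator[OF _ iV, of "A x"] by (simp add: mult.commute)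
    have "(LINT \<omega>|M. indicator {\<omega>. x < U \<omega>} \<omega> * (V \<omega> - expectation V))
        = (LINT \<omega>|M. V \<omega> * indicator (A x) \<omega> - expectation V * indicator (A x) \<omega>)"
      by (intro Bochner_Integration.integral_cong) (auto simp: A_def indicator_def)
    also have "\<dots> = (LINT \<omega>|M. V \<omega> * indicator (A x) \<omega>) - expectation V * measure M (A x)"
      using iVA by (subst Bochner_Integration.integral_diff) (auto simp: emeasure_eq_measure)
    also have "\<dots> = (LINT \<omega>|M. V \<omega> * indicator (A x) \<omega> - V \<omega> * measure M (A x))"
      using iVA iV by (subst Bochner_Integration.integral_diff) auto
    also have "\<dots> = (LINT \<omega>|M. V \<omega> * (indicator (A x) \<omega> - measure M (A x)))"
      by (simp add: right_diff_distrib)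
    finally show "\<bar>LINT \<omega>|M. indicator {\<omega>. x < U \<omega>} \<omega> * (V \<omega> - expectation V)\<bar> \<le> 2 * c * a"
      using one[of x] by simp
  qed (use bU iV in auto)
  also have "(LINT \<omega>|M. U \<omega> * (V \<omega> - expectation V)) = (LINT \<omega>|M. X \<omega> * Y \<omega>) - expectation X * expectation Y"
  proof -
    have "expectation V = expectation Y + c" using iY unfolding V_def by (simp add: prob_space)
    then have "(LINT \<omega>|M. U \<omega> * (V \<omega> - expectation V))
      = (LINT \<omega>|M. X \<omega> * Y \<omega> - expectation Y * X \<omega> + c * (Y \<omega> - expectation Y))"
      by (intro Bochner_Integration.integral_cong) (auto simp: U_def V_def algebra_simps)
    also have "\<dots> = (LINT \<omega>|M. X \<omega> * Y \<omega>) - expectation Y * expectation X"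
      using iX iY iXY by (simp add: prob_space)
    finally show ?thesis by simp
  qed
  finally show ?thesis by (simp add: power2_eq_square)
qed

section \<open>Integrals against scaled product kernels\<close>
text \<open>This is Hoelder's inequality with the power of \<open>h\<close> made explicit. Young's inequality is applied to
\<open>l F\<close> and \<open>G / l\<close>, where \<open>G\<close> is the product of the two kernel factors. Substitution gives
\<open>G\<close> an integral of order \<open>h\<^sup>2\<close> for its \<open>q\<close>-th power, and the weight \<open>l = h powr (2 / (p q))\<close> is
the one for which both Young terms are of the same order \<open>h powr (2 / q)\<close>.\<close>
lemma abs_integral_mult_scaled_product_le:
  fixes F :: "real \<times> real \<Rightarrow> real" and K :: "real \<Rightarrow> real" and p q C h z :: real
  assumes pq: "1 < p" "1 < q" "1 / p + 1 / q = 1"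
    and F: "F \<in> Lp_space lborel p" "Lp_norm lborel p F \<le> C"
    and K[measurable]: "K \<in> borel_measurable borel"
    and iK: "integrable lborel (\<lambda>u. \<bar>K u\<bar> powr q)"
    and h: "0 < h"
  shows "\<bar>LBINT w. F w * (K ((fst w - z) / h) * K ((snd w - z) / h))\<bar>
    \<le> (C powr p / p + (LBINT u. \<bar>K u\<bar> powr q)\<^sup>2 / q) * h powr (2 / q)"
proof -
  define G where "G w = K ((fst w - z) / h) * K ((snd w - z) / h)" for w
  define N where "N = (LBINT u. \<bar>K u\<bar> powr q)"
  have mF[measurable]: "F \<in> borel_measurable borel" and iF: "integrable lborel (\<lambda>w. \<bar>F w\<bar> powr p)"
    using F by (auto simp: Lp_space_def)
  have mG[measurable]: "G \<in> borel_measurable borel"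
    unfolding G_def borel_prod[symmetric] by measurable
  have "has_bochner_integral lborel (\<lambda>u. \<bar>K u\<bar> powr q) N"
    using iK by (simp add: has_bochner_integral_iff N_def)
  then have scale: "has_bochner_integral lborel (\<lambda>x. \<bar>K ((x - z) / h)\<bar> powr q) (h * N)"
    using lborel_has_bochner_integral_real_affine_iff[of "1 / h" "\<lambda>u. \<bar>K u\<bar> powr q" N "- z / h"] h
    by (simp add: diff_divide_distrib divideR_right)
  have G: "has_bochner_integral lborel (\<lambda>w. \<bar>G w\<bar> powr q) (h\<^sup>2 * N\<^sup>2)"
    using lborel_pair.has_bochner_integral_mult[of "\<lambda>x. \<bar>K ((x - z) / h)\<bar> powr q" "\<lambda>x. \<bar>K ((x - z) / h)\<bar> powr q"] scale
    by (simp add: has_bochner_integral_iff lborel_prod G_def abs_mult powr_mult split_beta' power2_eq_square mult_ac)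
  \<comment> \<open>The weight in Young's inequality that makes its two terms of equal order.\<close>
  define l where "l = h powr (2 / (p * q))"
  have l: "0 < l" using h by (simp add: l_def)
  have lp: "l powr p = h powr (2 / q)" using pq by (simp add: l_def powr_powr)
  have lq: "(1 / l) powr q * h\<^sup>2 = h powr (2 / q)"
  proof -
    have "(1 / l) powr q = h powr (- (2 / p))"
      using pq h by (simp add: l_def powr_divide powr_powr powr_minus_divide)
    moreover have "h\<^sup>2 = h powr 2" using h by (simp add: powr_numeral)
    ultimately have "(1 / l) powr q * h\<^sup>2 = h powr (- (2 / p) + 2)"
      by (simp only: powr_add)
    also have "- (2 / p) + 2 = 2 / q" using pq by (simp add: field_simps)
    finally show ?thesis .
  qed
  have young: "\<bar>F w * G w\<bar> \<le> (l powr p / p) * \<bar>F w\<bar> powr p + ((1 / l) powr q / q) * \<bar>G w\<bar> powr q" for w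
    using Youngs_inequality[OF pq, of "l * \<bar>F w\<bar>" "(1 / l) * \<bar>G w\<bar>"] l
    by (simp add: abs_mult powr_mult powr_divide)
  have iFG: "integrable lborel (\<lambda>w. (l powr p / p) * \<bar>F w\<bar> powr p + ((1 / l) powr q / q) * \<bar>G w\<bar> powr q)"
    using iF G by (auto simp: has_bochner_integral_iff)
  have Fp: "(LBINT w. \<bar>F w\<bar> powr p) \<le> C powr p"
  proof -
    have "(LBINT w. \<bar>F w\<bar> powr p) = Lp_norm lborel p F powr p"
      using pq by (simp add: Lp_norm_def powr_powr)
    also have "\<dots> \<le> C powr p"
      using F pq by (intro powr_mono2) (auto simp: Lp_norm_def)
    finally show ?thesis .
  qed
  have "\<bar>LBINT w. F w * G w\<bar> \<le> (LBINT w. \<bar>F w * G w\<bar>)" by (rule integral_abs_bound)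
  also have "\<dots> \<le> (LBINT w. (l powr p / p) * \<bar>F w\<bar> powr p + ((1 / l) powr q / q) * \<bar>G w\<bar> powr q)"
  proof (rule integral_mono[OF _ iFG young])
    show "integrable lborel (\<lambda>w. \<bar>F w * G w\<bar>)"
    proof (rule Bochner_Integration.integrable_bound[OF iFG])
      show "AE w in lborel. norm \<bar>F w * G w\<bar>
          \<le> norm (l powr p / p * \<bar>F w\<bar> powr p + (1 / l) powr q / q * \<bar>G w\<bar> powr q)"
        using order_trans[OF young abs_ge_self] by (simp only: real_norm_def abs_idempotent) simp
    qed measurable
  qed
  also have "\<dots> = (l powr p / p) * (LBINT w. \<bar>F w\<bar> powr p) + ((1 / l) powr q / q) * (h\<^sup>2 * N\<^sup>2)"
    using iF G by (simp add: has_bochner_integral_iff)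
  also have "\<dots> = h powr (2 / q) * ((LBINT w. \<bar>F w\<bar> powr p) / p + N\<^sup>2 / q)"
    unfolding lp lq[symmetric] by (simp add: field_simps lq[unfolded power2_eq_square] lp power2_eq_square)
  also have "\<dots> \<le> h powr (2 / q) * (C powr p / p + N\<^sup>2 / q)"
    using Fp pq by (intro mult_left_mono add_right_mono divide_right_mono) auto
  finally show ?thesis by (simp add: G_def N_def mult_ac)
qed

section \<open>Second moment of a sum\<close>
text \<open>In each row of the double sum every lag occurs at most twice, once on either side of the
diagonal.\<close>
lemma integral_square_sum_le:
  fixes Y :: "nat \<Rightarrow> 'w \<Rightarrow> real" and c :: "nat \<Rightarrow> real"
  assumes int: "\<And>t u. integrable M (\<lambda>\<omega>. Y t \<omega> * Y u \<omega>)"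
    and diag: "\<And>t. (LINT \<omega>|M. (Y t \<omega>)\<^sup>2) \<le> d"
    and off: "\<And>t u. t < u \<Longrightarrow> (LINT \<omega>|M. Y t \<omega> * Y u \<omega>) \<le> c (u - t)"
    and c: "\<And>k. 0 \<le> c k"
  shows "(LINT \<omega>|M. (\<Sum>t=1..T. Y t \<omega>)\<^sup>2) \<le> real T * (d + 2 * (\<Sum>k=1..T. c k))"
proof -
  define E where "E t u = (LINT \<omega>|M. Y t \<omega> * Y u \<omega>)" for t u
  have row: "(\<Sum>u=1..T. E t u) \<le> d + 2 * (\<Sum>k=1..T. c k)" if t: "t \<in> {1..T}" for t
  proof -
    have "{1..T} = insert t ({1..<t} \<union> {t<..T})" using t by auto
    then have "(\<Sum>u=1..T. E t u) = (\<Sum>u\<in>insert t ({1..<t} \<union> {t<..T}). E t u)" by simp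
    also have "\<dots> = E t t + ((\<Sum>u\<in>{1..<t}. E t u) + (\<Sum>u\<in>{t<..T}. E t u))"
      by (subst sum.insert) (auto intro!: sum.union_disjoint)
    also have "E t t \<le> d" using diag[of t] by (simp add: E_def power2_eq_square)
    also have "(\<Sum>u\<in>{1..<t}. E t u) \<le> (\<Sum>k=1..T. c k)"
    proof -
      have "(\<Sum>u\<in>{1..<t}. E t u) \<le> (\<Sum>u\<in>{1..<t}. c (t - u))"
        using off by (intro sum_mono) (auto simp: E_def mult.commute)
      also have "\<dots> = (\<Sum>k\<in>(\<lambda>u. t - u) ` {1..<t}. c k)"
        by (subst sum.reindex) (auto simp: inj_on_def)
      also have "\<dots> \<le> (\<Sum>k=1..T. c k)" using t c by (intro sum_mono2) auto
      finally show ?thesis .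
    qed
    also have "(\<Sum>u\<in>{t<..T}. E t u) \<le> (\<Sum>k=1..T. c k)"
    proof -
      have "(\<Sum>u\<in>{t<..T}. E t u) \<le> (\<Sum>u\<in>{t<..T}. c (u - t))"
        using off by (intro sum_mono) (auto simp: E_def)
      also have "\<dots> = (\<Sum>k\<in>(\<lambda>u. u - t) ` {t<..T}. c k)"
        by (subst sum.reindex) (auto simp: inj_on_def)
      also have "\<dots> \<le> (\<Sum>k=1..T. c k)" using t c by (intro sum_mono2) auto
      finally show ?thesis .
    qed
    finally show ?thesis by simp
  qed
  have "(LINT \<omega>|M. (\<Sum>t=1..T. Y t \<omega>)\<^sup>2) = (\<Sum>t=1..T. \<Sum>u=1..T. E t u)"
    unfolding power2_eq_square sum_product E_def using int by (simp add: Bochner_Integration.integral_sum)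
  also have "\<dots> \<le> (\<Sum>t=1..T. d + 2 * (\<Sum>k=1..T. c k))" using row by (intro sum_mono)
  finally show ?thesis by simp
qed

section \<open>Bias of the kernel estimator\<close>
text \<open>The class controls the Taylor remainder only within distance \<open>\<rho>\<close>. At distance at least \<open>\<rho>\<close>
the bounded function and every monomial of degree less than \<open>s\<close> are at most a constant times
\<open>\<bar>x\<bar> powr s\<close>, so with a larger constant, which may depend on the point \<open>z\<close>, the bound is global.
This spares a separate treatment of the tails of the kernel.\<close>
lemma smooth_class_global_Taylor_bound:
  fixes f :: "real \<Rightarrow> real" and z :: real
  assumes "f \<in> smooth_class s \<Delta>" "0 < s" "bounded (range f)"
  obtains m :: nat and C :: real and a :: "nat \<Rightarrow> real" where
    "real m - 1 < s" "0 \<le> C"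
    "\<And>x. \<bar>f (z + x) - f z - (\<Sum>k=1..m - 1. a k * x ^ k)\<bar> \<le> C * \<bar>x\<bar> powr s"
proof -
  obtain m :: nat and \<rho> where m: "real m - 1 < s" "s \<le> real m" and "0 < \<rho>"
    and loc: "\<And>x y. y \<noteq> x \<and> \<bar>y - x\<bar> < \<rho> \<Longrightarrow>
        \<bar>f y - f x - (\<Sum>k=1..m - 1. (deriv ^^ k) f x / fact k * (y - x) ^ k)\<bar> / \<bar>y - x\<bar> powr s \<le> \<Delta>"
    using assms(1) unfolding smooth_class_def by blast
  obtain B where B: "\<And>x. \<bar>f x\<bar> \<le> B"
    using assms(3) by (auto simp: bounded_iff)
  define a where "a k = (deriv ^^ k) f z / fact k" for k
  define C where "C = \<bar>\<Delta>\<bar> + (2 * B * \<rho> powr (- s) + (\<Sum>k=1..m - 1. \<bar>a k\<bar> * \<rho> powr (real k - s)))"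
  have "0 \<le> B" using B[of 0] by linarith
  then have pos: "0 \<le> 2 * B * \<rho> powr (- s) + (\<Sum>k=1..m - 1. \<bar>a k\<bar> * \<rho> powr (real k - s))"
    by (auto intro!: add_nonneg_nonneg sum_nonneg)
  show ?thesis
  proof (rule that[of m C a])
    show "0 \<le> C" using pos by (simp add: C_def)
    fix x :: real
    let ?R = "f (z + x) - f z - (\<Sum>k=1..m - 1. a k * x ^ k)"
    consider "x = 0" | "x \<noteq> 0" "\<bar>x\<bar> < \<rho>" | "\<rho> \<le> \<bar>x\<bar>" by linarith
    then show "\<bar>?R\<bar> \<le> C * \<bar>x\<bar> powr s"
    proof cases
      case 1 then show ?thesis by simp
    next
      case 2
      then have "\<bar>?R\<bar> / \<bar>x\<bar> powr s \<le> \<Delta>" using loc[of "z + x" z] by (simp add: a_def)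
      then have "\<bar>?R\<bar> \<le> \<Delta> * \<bar>x\<bar> powr s" using 2 by (simp add: field_simps)
      also have "\<dots> \<le> C * \<bar>x\<bar> powr s" using pos by (intro mult_right_mono) (auto simp: C_def)
      finally show ?thesis .
    next
      case 3
      then have x: "0 < \<bar>x\<bar>" using \<open>0 < \<rho>\<close> by linarith
      have tail: "\<bar>x\<bar> powr e \<le> \<rho> powr (e - s) * \<bar>x\<bar> powr s" if "e \<le> s" for e
      proof -
        have "\<bar>x\<bar> powr (e - s) \<le> \<rho> powr (e - s)"
          using that 3 \<open>0 < \<rho>\<close> by (intro powr_mono2') auto
        then have "\<bar>x\<bar> powr (e - s) * \<bar>x\<bar> powr s \<le> \<rho> powr (e - s) * \<bar>x\<bar> powr s"
          by (rule mult_right_mono) simp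
        then show ?thesis by (simp flip: powr_add)
      qed
      have "\<bar>?R\<bar> \<le> \<bar>f (z + x)\<bar> + \<bar>f z\<bar> + \<bar>\<Sum>k=1..m - 1. a k * x ^ k\<bar>" by linarith
      also have "\<bar>\<Sum>k=1..m - 1. a k * x ^ k\<bar> \<le> (\<Sum>k=1..m - 1. \<bar>a k * x ^ k\<bar>)" by (rule sum_abs)
      also have "\<bar>f (z + x)\<bar> + \<bar>f z\<bar> \<le> 2 * B * \<bar>x\<bar> powr 0"
        using B[of "z + x"] B[of z] x by simp
      also have "\<dots> \<le> 2 * B * (\<rho> powr (0 - s) * \<bar>x\<bar> powr s)"
        using tail[of 0] \<open>0 < s\<close> \<open>0 \<le> B\<close> by (intro mult_left_mono) auto
      also have "(\<Sum>k=1..m - 1. \<bar>a k * x ^ k\<bar>)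
        \<le> (\<Sum>k=1..m - 1. \<bar>a k\<bar> * (\<rho> powr (real k - s) * \<bar>x\<bar> powr s))"
      proof (rule sum_mono)
        fix k assume "k \<in> {1..m - 1}"
        then have "real k \<le> s" using m by auto
        then have "\<bar>x\<bar> ^ k \<le> \<rho> powr (real k - s) * \<bar>x\<bar> powr s"
          using tail[of "real k"] x by (simp add: powr_realpow)
        then show "\<bar>a k * x ^ k\<bar> \<le> \<bar>a k\<bar> * (\<rho> powr (real k - s) * \<bar>x\<bar> powr s)"
          by (simp add: abs_mult power_abs mult_left_mono)
      qed
      finally have "\<bar>?R\<bar> \<le> (2 * B * \<rho> powr (- s) + (\<Sum>k=1..m - 1. \<bar>a k\<bar> * \<rho> powr (real k - s))) * \<bar>x\<bar> powr s"
        by (simp add: algebra_simps sum_distrib_right sum_distrib_left)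
      also have "\<dots> \<le> C * \<bar>x\<bar> powr s" by (intro mult_right_mono) (auto simp: C_def)
      finally show ?thesis .
    qed
  qed (use m in auto)
qed

text \<open>Substituting \<open>x = z + h u\<close>, the bias is the integral of \<open>K(u) (f(z + h u) - f(z))\<close>. The Taylor
polynomial has degree less than \<open>s \<le> r\<close>, so the vanishing moments of \<open>K\<close> annihilate it, and the
remainder contributes \<open>h powr s\<close> times the absolute moment of order \<open>s\<close>. That moment is finite
because \<open>\<bar>u\<bar> powr s \<le> 1 + \<bar>u\<bar> ^ r\<close>.\<close>
lemma kernel_bias_le:
  fixes f K :: "real \<Rightarrow> real" and z :: real
  assumes f: "f \<in> smooth_class s \<Delta>" "0 < s" "bounded (range f)"
    and [measurable]: "f \<in> borel_measurable borel"
    and K: "kernel_of_order r K" "s \<le> real r"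
  obtains C where "0 \<le> C"
    "\<And>h. 0 < h \<Longrightarrow> \<bar>(LBINT x. f x * scaled_kernel K h (x - z)) - f z\<bar> \<le> C * h powr s"
proof -
  obtain m :: nat and C :: real and a :: "nat \<Rightarrow> real" where m: "real m - 1 < s" and "0 \<le> C"
    and Taylor: "\<And>x. \<bar>f (z + x) - f z - (\<Sum>k=1..m - 1. a k * x ^ k)\<bar> \<le> C * \<bar>x\<bar> powr s"
    by (rule smooth_class_global_Taylor_bound[OF f, of z]) (rule that)
  have K1: "has_bochner_integral lborel K 1"
    and moments: "\<And>i. i \<in> {1..<r} \<Longrightarrow> has_bochner_integral lborel (\<lambda>u. u ^ i * K u) 0"
    and top: "integrable lborel (\<lambda>u. \<bar>u\<bar> ^ r * K u)"
    using K(1) by (auto simp: kernel_of_order_def has_bochner_integral_iff)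
  have iK: "integrable lborel K" using K1 by (simp add: has_bochner_integral_iff)
  then have [measurable]: "K \<in> borel_measurable borel" using borel_measurable_integrable by fastforce
  have "0 < r" using K(2) \<open>0 < s\<close> by (cases r) auto
  have iKs: "integrable lborel (\<lambda>u. \<bar>u\<bar> powr s * \<bar>K u\<bar>)"
  proof (rule Bochner_Integration.integrable_bound)
    show "integrable lborel (\<lambda>u. \<bar>K u\<bar> + \<bar>\<bar>u\<bar> ^ r * K u\<bar>)" using iK top by simp
    have "\<bar>u\<bar> powr s \<le> 1 + \<bar>u\<bar> ^ r" for u :: real
    proof (cases "\<bar>u\<bar> \<le> 1")
      case True
      then have "\<bar>u\<bar> powr s \<le> 1 powr s" using \<open>0 < s\<close> by (intro powr_mono2) auto
      then show ?thesis by (simp add: add_increasing2)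
    next
      case False
      then have "\<bar>u\<bar> powr s \<le> \<bar>u\<bar> powr real r" using K by (intro powr_mono) auto
      then show ?thesis using False by (simp add: powr_realpow)
    qed
    from mult_right_mono[OF this, of "\<bar>K u\<bar>" for u]
    show "AE u in lborel. norm (\<bar>u\<bar> powr s * \<bar>K u\<bar>) \<le> norm (\<bar>K u\<bar> + \<bar>\<bar>u\<bar> ^ r * K u\<bar>)"
      by (auto simp: abs_mult distrib_right)
  qed measurable
  define N where "N = (LBINT u. \<bar>u\<bar> powr s * \<bar>K u\<bar>)"
  have "0 \<le> N" by (simp add: N_def)
  show ?thesis
  proof (rule that[of "C * N"])
    show "0 \<le> C * N" using \<open>0 \<le> C\<close> \<open>0 \<le> N\<close> by simp
    fix h :: real assume h: "0 < h"
    let ?Q = "\<lambda>u. (\<Sum>k=1..m - 1. a k * (h * u) ^ k)"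
    have poly: "has_bochner_integral lborel (\<lambda>u. ?Q u * K u) 0"
    proof -
      have "has_bochner_integral lborel (\<lambda>u. \<Sum>k=1..m - 1. (a k * h ^ k) * (u ^ k * K u)) (\<Sum>k=1..m - 1. (a k * h ^ k) * 0)"
      proof (intro has_bochner_integral_sum has_bochner_integral_mult_right moments)
        fix k assume "k \<in> {1..m - 1}"
        then have "real k < real r" using m K(2) by auto
        then show "k \<in> {1..<r}" using \<open>k \<in> {1..m - 1}\<close> by auto
      qed
      then show ?thesis by (simp add: sum_distrib_left sum_distrib_right power_mult_distrib mult_ac)
    qed
    obtain B where B: "\<And>x. \<bar>f x\<bar> \<le> B" using f(3) by (auto simp: bounded_iff)
    have ifK: "integrable lborel (\<lambda>u. f (z + h * u) * K u)"
    proof (rule Bochner_Integration.integrable_bound)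
      show "integrable lborel (\<lambda>u. B * \<bar>K u\<bar>)" using iK by simp
      show "AE u in lborel. norm (f (z + h * u) * K u) \<le> norm (B * \<bar>K u\<bar>)"
        using B by (auto simp: abs_mult intro!: mult_right_mono order_trans[OF B abs_ge_self])
    qed measurable
    have rep: "(LBINT x. f x * scaled_kernel K h (x - z)) = (LBINT u. f (z + h * u) * K u)"
      using h by (subst lborel_integral_real_affine[of h _ z]) (auto simp: scaled_kernel_def)
    have "(LBINT u. f (z + h * u) * K u) - f z
       = (LBINT u. (f (z + h * u) - f z - ?Q u) * K u)"
    proof -
      have "(LBINT u. (f (z + h * u) - f z - ?Q u) * K u)
        = (LBINT u. f (z + h * u) * K u - f z * K u - ?Q u * K u)"
        by (simp add: left_diff_distrib)
      also have "\<dots> = (LBINT u. f (z + h * u) * K u) - f z"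
        using ifK iK K1 poly by (simp add: has_bochner_integral_iff)
      finally show ?thesis by simp
    qed
    also have "\<bar>\<dots>\<bar> \<le> (LBINT u. C * h powr s * (\<bar>u\<bar> powr s * \<bar>K u\<bar>))"
    proof (rule order_trans[OF integral_abs_bound], rule integral_mono)
      show "integrable lborel (\<lambda>u. \<bar>(f (z + h * u) - f z - ?Q u) * K u\<bar>)"
        using ifK iK poly by (simp add: left_diff_distrib has_bochner_integral_iff)
      show "integrable lborel (\<lambda>u. C * h powr s * (\<bar>u\<bar> powr s * \<bar>K u\<bar>))" using iKs by simp
      fix u
      have "\<bar>f (z + h * u) - f z - ?Q u\<bar> \<le> C * (h powr s * \<bar>u\<bar> powr s)"
        using Taylor[of "h * u"] h by (simp add: abs_mult powr_mult)
      from mult_right_mono[OF this, of "\<bar>K u\<bar>"]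
      show "\<bar>(f (z + h * u) - f z - ?Q u) * K u\<bar> \<le> C * h powr s * (\<bar>u\<bar> powr s * \<bar>K u\<bar>)"
        by (simp add: abs_mult mult_ac)
    qed
    also have "\<dots> = C * N * h powr s" by (simp add: N_def)
    finally show "\<bar>(LBINT x. f x * scaled_kernel K h (x - z)) - f z\<bar> \<le> C * N * h powr s"
      unfolding rep .
  qed
qed

section \<open>Covariances of the kernel terms\<close>
text \<open>One constant serves all test functions and all pairs of times; what matters later is that the
test function \<open>g\<close> may depend on the bandwidth, entering only through its bound \<open>c\<close>.\<close>
lemma two_mixing_covariance_le:
  assumes "prob_space M" "two_mixing M Z v" and Z[measurable]: "\<And>t. Z t \<in> borel_measurable M"
  obtains C where "0 \<le> C"
    "\<And>g c t u. g \<in> borel_measurable borel \<Longrightarrow> (\<And>x. \<bar>g x\<bar> \<le> c) \<Longrightarrow> t \<noteq> u \<Longrightarrow>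
      \<bar>(LINT \<omega>|M. g (Z t \<omega>) * g (Z u \<omega>)) - (LINT \<omega>|M. g (Z t \<omega>)) * (LINT \<omega>|M. g (Z u \<omega>))\<bar>
        \<le> C * c\<^sup>2 * real_of_int \<bar>t - u\<bar> powr (- v)"
proof -
  interpret prob_space M by fact
  obtain C where C: "\<And>t u. t \<noteq> u \<Longrightarrow>
        (SUP (A, B) \<in> generated_sigma M (Z t) \<times> generated_sigma M (Z u).
           \<bar>measure M (A \<inter> B) - measure M A * measure M B\<bar>)
        \<le> C * real_of_int \<bar>t - u\<bar> powr (- v)"
    using assms(2) unfolding two_mixing_def by blast
  \<comment> \<open>The supremum bounds its terms because the set of values is bounded above, by 1.\<close>
  have mix: "\<bar>measure M (A \<inter> B) - measure M A * measure M B\<bar> \<le> \<bar>C\<bar> * real_of_int \<bar>t - u\<bar> powr (- v)"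
    if "A \<in> generated_sigma M (Z t)" "B \<in> generated_sigma M (Z u)" "t \<noteq> u" for A B t u
  proof -
    let ?d = "\<lambda>(A, B). \<bar>measure M (A \<inter> B) - measure M A * measure M B\<bar>"
    have "\<bar>measure M (A \<inter> B) - measure M A * measure M B\<bar> \<le> 1" for A B
    proof -
      have "measure M A * measure M B \<le> 1" by (simp add: mult_le_one)
      moreover have "0 \<le> measure M A * measure M B" by simp
      moreover have "measure M (A \<inter> B) \<le> 1" "0 \<le> measure M (A \<inter> B)" by simp_all
      ultimately show ?thesis by linarith
    qed
    then have "bdd_above (?d ` (generated_sigma M (Z t) \<times> generated_sigma M (Z u)))"
      by (intro bdd_aboveI[where M=1]) auto
    then have "?d (A, B) \<le> (SUP p \<in> generated_sigma M (Z t) \<times> generated_sigma M (Z u). ?d p)"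
      using that by (intro cSUP_upper) auto
    also have "\<dots> \<le> C * real_of_int \<bar>t - u\<bar> powr (- v)" using C[OF \<open>t \<noteq> u\<close>] by simp
    also have "\<dots> \<le> \<bar>C\<bar> * real_of_int \<bar>t - u\<bar> powr (- v)" by (intro mult_right_mono) auto
    finally show ?thesis by simp
  qed
  show ?thesis
  proof (rule that[of "4 * \<bar>C\<bar>"])
    fix g :: "real \<Rightarrow> real" and c :: real and t u :: int
    assume [measurable]: "g \<in> borel_measurable borel" and g: "\<And>x. \<bar>g x\<bar> \<le> c" and "t \<noteq> u"
    have gen: "{\<omega> \<in> space M. x < g (Z t \<omega>)} \<in> generated_sigma M (Z t)" for x t
    proof -
      have "{y. x < g y} \<in> sets borel" by measurable
      then have "Z t -` {y. x < g y} \<inter> space M \<in> sets (vimage_algebra (space M) (Z t) borel)"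
        by (rule in_vimage_algebra)
      also have "Z t -` {y. x < g y} \<inter> space M = {\<omega> \<in> space M. x < g (Z t \<omega>)}" by auto
      finally show ?thesis by (simp add: generated_sigma_def)
    qed
    have "\<bar>(LINT \<omega>|M. g (Z t \<omega>) * g (Z u \<omega>)) - (LINT \<omega>|M. g (Z t \<omega>)) * (LINT \<omega>|M. g (Z u \<omega>))\<bar>
        \<le> 4 * c\<^sup>2 * (\<bar>C\<bar> * real_of_int \<bar>t - u\<bar> powr (- v))"
      using g mix[OF gen gen \<open>t \<noteq> u\<close>]
      by (intro abs_covariance_le_of_superlevel_sets[OF assms(1)]) auto
    then show "\<bar>(LINT \<omega>|M. g (Z t \<omega>) * g (Z u \<omega>)) - (LINT \<omega>|M. g (Z t \<omega>)) * (LINT \<omega>|M. g (Z u \<omega>))\<bar>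
        \<le> 4 * \<bar>C\<bar> * c\<^sup>2 * real_of_int \<bar>t - u\<bar> powr (- v)"
      by (simp add: mult_ac)
  qed simp
qed

text \<open>Moves a pair of times back to a pair \<open>(0, t)\<close>, where the norm of the density difference is
controlled.\<close>
lemma stationary_process_integral_shift:
  fixes \<phi> :: "real \<times> real \<Rightarrow> real"
  assumes "stationary_process M Z" and [measurable]: "\<phi> \<in> borel_measurable borel"
  shows "(LINT \<omega>|M. \<phi> (Z (t + k) \<omega>, Z (u + k) \<omega>)) = (LINT \<omega>|M. \<phi> (Z t \<omega>, Z u \<omega>))"
proof -
  let ?P = "Pi\<^sub>M UNIV (\<lambda>_::int. borel :: real measure)"
  have Z: "\<And>t. Z t \<in> borel_measurable M"
    and eq: "distr M ?P (\<lambda>\<omega> t. Z (t + k) \<omega>) = distr M ?P (\<lambda>\<omega> t. Z t \<omega>)"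
    using assms(1) by (auto simp: stationary_process_def)
  have path[measurable]: "(\<lambda>\<omega> t. Z (t + k) \<omega>) \<in> measurable M ?P" for k
    by (rule measurable_PiM_single') (use Z in auto)
  have path0: "(\<lambda>\<omega> t. Z t \<omega>) \<in> measurable M ?P" using path[of 0] by simp
  have coord: "(\<lambda>x. \<phi> (x t, x u)) \<in> borel_measurable ?P"
  proof -
    have "(\<lambda>x. (x t, x u)) \<in> measurable ?P (borel \<Otimes>\<^sub>M borel)"
      by (intro measurable_Pair measurable_component_singleton) auto
    then show ?thesis unfolding borel_prod by (rule measurable_compose) fact
  qed
  have "(LINT \<omega>|M. \<phi> (Z (t + k) \<omega>, Z (u + k) \<omega>)) = (LINT x|distr M ?P (\<lambda>\<omega> t. Z (t + k) \<omega>). \<phi> (x t, x u))"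
    by (subst integral_distr[OF path coord]) simp
  also have "\<dots> = (LINT \<omega>|M. \<phi> (Z t \<omega>, Z u \<omega>))"
    unfolding eq by (subst integral_distr[OF path0 coord]) simp
  finally show ?thesis .
qed

lemma covariance_eq_integral_density_difference:
  fixes X Y :: "'w \<Rightarrow> real" and f :: "real \<Rightarrow> real" and f2 F :: "real \<times> real \<Rightarrow> real"
  assumes "prob_space M"
    and X: "distributed M lborel X (\<lambda>x. ennreal (f x))"
    and Y: "distributed M lborel Y (\<lambda>x. ennreal (f x))" and f: "\<And>x. 0 \<le> f x"
    and XY: "distributed M lborel (\<lambda>\<omega>. (X \<omega>, Y \<omega>)) (\<lambda>x. ennreal (f2 x))" and f2: "\<And>x. 0 \<le> f2 x"
    and F: "\<And>x y. F (x, y) = f2 (x, y) - f x * f y"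
    and g[measurable]: "g \<in> borel_measurable borel" and bg: "\<And>x. \<bar>g x\<bar> \<le> c"
  shows "(LINT \<omega>|M. g (X \<omega>) * g (Y \<omega>)) - (LINT \<omega>|M. g (X \<omega>)) * (LINT \<omega>|M. g (Y \<omega>))
    = (LBINT w. F w * (g (fst w) * g (snd w)))"
proof -
  interpret prob_space M by fact
  have [measurable]: "X \<in> borel_measurable M" "Y \<in> borel_measurable M"
    using X Y by (auto dest!: distributed_measurable)
  let ?G = "\<lambda>w. g (fst w) * g (snd w)"
  have G[measurable]: "?G \<in> borel_measurable borel"
    unfolding borel_prod[symmetric] by measurable
  have iX: "integrable M (\<lambda>\<omega>. g (X \<omega>))"
    using bg by (intro integrable_const_bound[where B=c]) auto
  have ifg: "integrable lborel (\<lambda>x. f x * g x)"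
    using distributed_integrable[OF X, of g] f iX by simp
  have i2: "integrable lborel (\<lambda>w. f2 w * ?G w)"
  proof -
    have "integrable M (\<lambda>\<omega>. g (X \<omega>) * g (Y \<omega>))"
      using bg by (intro integrable_const_bound[where B="c * c"])
        (auto simp: abs_mult intro!: mult_mono order_trans[OF abs_ge_zero])
    then show ?thesis using distributed_integrable[OF XY, of ?G] f2 by simp
  qed
  have prod: "has_bochner_integral lborel (\<lambda>w. (f (fst w) * g (fst w)) * (f (snd w) * g (snd w)))
      ((LINT \<omega>|M. g (X \<omega>)) * (LINT \<omega>|M. g (Y \<omega>)))"
    using lborel_pair.has_bochner_integral_mult[OF ifg ifg]
      distributed_integral[OF X, of g] distributed_integral[OF Y, of g] f
    by (simp add: lborel_prod split_beta')
  have "(LBINT w. F w * ?G w)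
      = (LBINT w. f2 w * ?G w - (f (fst w) * g (fst w)) * (f (snd w) * g (snd w)))"
    by (intro Bochner_Integration.integral_cong) (auto simp: F algebra_simps)
  also have "\<dots> = (LBINT w. f2 w * ?G w) - (LINT \<omega>|M. g (X \<omega>)) * (LINT \<omega>|M. g (Y \<omega>))"
    using i2 prod by (simp add: has_bochner_integral_iff)
  also have "(LBINT w. f2 w * ?G w) = (LINT \<omega>|M. g (X \<omega>) * g (Y \<omega>))"
    using distributed_integral[OF XY, of ?G] f2 by simp
  finally show ?thesis by simp
qed

lemma integrable_powr_of_bounded:
  fixes K :: "real \<Rightarrow> real"
  assumes K: "integrable lborel K" and B: "\<And>x. \<bar>K x\<bar> \<le> B" and "1 \<le> q"
  shows "integrable lborel (\<lambda>x. \<bar>K x\<bar> powr q)"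
proof (rule Bochner_Integration.integrable_bound)
  have [measurable]: "K \<in> borel_measurable borel" using K borel_measurable_integrable by fastforce
  show "(\<lambda>x. \<bar>K x\<bar> powr q) \<in> borel_measurable lborel" by measurable
  show "integrable lborel (\<lambda>x. B powr (q - 1) * \<bar>K x\<bar>)" using K by simp
  have "\<bar>K x\<bar> powr q \<le> B powr (q - 1) * \<bar>K x\<bar>" for x
  proof -
    have "\<bar>K x\<bar> powr q = \<bar>K x\<bar> powr (q - 1) * \<bar>K x\<bar>"
      by (cases "K x = 0") (auto simp: powr_diff)
    also have "\<dots> \<le> B powr (q - 1) * \<bar>K x\<bar>"
      using B assms by (intro mult_right_mono powr_mono2) auto
    finally show ?thesis .
  qed
  then show "AE x in lborel. norm (\<bar>K x\<bar> powr q) \<le> norm (B powr (q - 1) * \<bar>K x\<bar>)" by auto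
qed

text \<open>The two sources of the minimum. The scaled kernel is bounded by a multiple of \<open>1 / h\<close>, so mixing
gives \<open>h powr (- 2)\<close> times the mixing rate. Alternatively, the covariance is the integral of the
density difference against the product of two scaled kernels; with \<open>q\<close> conjugate to \<open>p\<close> this is of order
\<open>h powr (2 / q - 2) = h powr (- (2 / p))\<close>, uniformly in the lag.\<close>
lemma kernel_covariance_le:
  fixes Z :: "int \<Rightarrow> 'w \<Rightarrow> real" and f K :: "real \<Rightarrow> real"
    and f2 F :: "int \<Rightarrow> int \<Rightarrow> real \<times> real \<Rightarrow> real" and v p z :: real
  assumes M: "prob_space M" and stat: "stationary_process M Z" and mixing: "two_mixing M Z v"
    and f: "\<And>x. 0 \<le> f x" "\<And>t. distributed M lborel (Z t) (\<lambda>x. ennreal (f x))"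
    and f2: "\<And>t u x. t \<noteq> u \<Longrightarrow> 0 \<le> f2 t u x"
      "\<And>t u. t \<noteq> u \<Longrightarrow> distributed M lborel (\<lambda>\<omega>. (Z t \<omega>, Z u \<omega>)) (\<lambda>x. ennreal (f2 t u x))"
    and F: "\<And>t u x y. t \<noteq> u \<Longrightarrow> F t u (x, y) = f2 t u (x, y) - f x * f y"
    and p: "2 < p"
    and FLp: "\<exists>C. \<forall>t. t \<noteq> 0 \<longrightarrow> F 0 t \<in> Lp_space lborel p \<and> Lp_norm lborel p (F 0 t) \<le> C"
    and K: "integrable lborel K" "bounded (range K)"
  obtains D where "0 \<le> D"
    "\<And>h t u. 0 < h \<Longrightarrow> t < u \<Longrightarrow>
      (LINT \<omega>|M. scaled_kernel K h (Z t \<omega> - z) * scaled_kernel K h (Z u \<omega> - z))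
        - (LINT \<omega>|M. scaled_kernel K h (Z t \<omega> - z)) * (LINT \<omega>|M. scaled_kernel K h (Z u \<omega> - z))
      \<le> D * min (h powr (- (2 / p))) (h powr (- 2) * real_of_int (u - t) powr (- v))"
proof -
  interpret prob_space M by fact
  have [measurable]: "K \<in> borel_measurable borel" using K(1) borel_measurable_integrable by fastforce
  have Z[measurable]: "\<And>t. Z t \<in> borel_measurable M" using stat by (auto simp: stationary_process_def)
  obtain \<kappa> where \<kappa>: "\<And>x. \<bar>K x\<bar> \<le> \<kappa>" using K(2) by (auto simp: bounded_iff)
  obtain C1 where C1: "0 \<le> C1"
    "\<And>g c t u. g \<in> borel_measurable borel \<Longrightarrow> (\<And>x. \<bar>g x\<bar> \<le> c) \<Longrightarrow> t \<noteq> u \<Longrightarrow>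
      \<bar>(LINT \<omega>|M. g (Z t \<omega>) * g (Z u \<omega>)) - (LINT \<omega>|M. g (Z t \<omega>)) * (LINT \<omega>|M. g (Z u \<omega>))\<bar>
        \<le> C1 * c\<^sup>2 * real_of_int \<bar>t - u\<bar> powr (- v)"
    by (rule two_mixing_covariance_le[OF M mixing Z]) (rule that, assumption, blast)
  obtain C where C: "\<And>t. t \<noteq> 0 \<Longrightarrow> F 0 t \<in> Lp_space lborel p \<and> Lp_norm lborel p (F 0 t) \<le> C"
    using FLp by blast
  define q where "q = p / (p - 1)"
  have q: "1 < p" "1 < q" "1 / p + 1 / q = 1" using p by (auto simp: q_def field_simps)
  define C2 where "C2 = C powr p / p + (LBINT u. \<bar>K u\<bar> powr q)\<^sup>2 / q"
  have "0 \<le> C2" using q by (simp add: C2_def)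
  show ?thesis
  proof (rule that[of "C1 * \<kappa>\<^sup>2 + C2"])
    show "0 \<le> C1 * \<kappa>\<^sup>2 + C2" using C1 \<open>0 \<le> C2\<close> by simp
    fix h :: real and t u :: int
    assume h: "0 < h" and tu: "t < u"
    define g where "g x = scaled_kernel K h (x - z)" for x
    have g[measurable]: "g \<in> borel_measurable borel" unfolding g_def scaled_kernel_def by measurable
    have bg: "\<bar>g x\<bar> \<le> \<kappa> / h" for x
      using \<kappa> h by (simp add: g_def scaled_kernel_def abs_divide divide_right_mono)
    let ?cov = "(LINT \<omega>|M. g (Z t \<omega>) * g (Z u \<omega>)) - (LINT \<omega>|M. g (Z t \<omega>)) * (LINT \<omega>|M. g (Z u \<omega>))"
    have "?cov \<le> C1 * (\<kappa> / h)\<^sup>2 * real_of_int \<bar>t - u\<bar> powr (- v)"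
      using C1(2)[OF g bg, of t u] tu by simp
    also have "\<dots> = C1 * \<kappa>\<^sup>2 * (h powr (- 2) * real_of_int (u - t) powr (- v))"
      using tu h by (simp add: power_divide powr_minus powr_numeral field_simps)
    also have "\<dots> \<le> (C1 * \<kappa>\<^sup>2 + C2) * (h powr (- 2) * real_of_int (u - t) powr (- v))"
      using \<open>0 \<le> C2\<close> by (intro mult_right_mono) auto
    finally have mix: "?cov \<le> (C1 * \<kappa>\<^sup>2 + C2) * (h powr (- 2) * real_of_int (u - t) powr (- v))" .
    have mean: "(LINT \<omega>|M. g (Z i \<omega>)) = (LBINT x. f x * g x)" for i
      using distributed_integral[OF f(2), of g i] f(1) by simp
    have "(LINT \<omega>|M. g (Z (0 + t) \<omega>) * g (Z ((u - t) + t) \<omega>)) = (LINT \<omega>|M. g (Z 0 \<omega>) * g (Z (u - t) \<omega>))"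
    proof -
      have "(\<lambda>w. g (fst w) * g (snd w)) \<in> borel_measurable borel"
        unfolding borel_prod[symmetric] by measurable
      from stationary_process_integral_shift[OF stat this, of 0 t "u - t"] show ?thesis by simp
    qed
    then have "?cov = (LINT \<omega>|M. g (Z 0 \<omega>) * g (Z (u - t) \<omega>)) - (LINT \<omega>|M. g (Z 0 \<omega>)) * (LINT \<omega>|M. g (Z (u - t) \<omega>))"
      by (simp add: mean)
    also have "\<dots> = (LBINT w. F 0 (u - t) w * (g (fst w) * g (snd w)))"
      using tu by (intro covariance_eq_integral_density_difference[OF M f(2) f(2) f(1) f2(2) f2(1) F g bg]) auto
    also have "\<dots> = (LBINT w. F 0 (u - t) w * (K ((fst w - z) / h) * K ((snd w - z) / h))) / h\<^sup>2"
      by (simp add: g_def scaled_kernel_def power2_eq_square)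
    also have "\<dots> \<le> C2 * h powr (2 / q) / h\<^sup>2"
    proof (rule divide_right_mono)
      have "integrable lborel (\<lambda>u. \<bar>K u\<bar> powr q)"
        using integrable_powr_of_bounded[OF K(1) \<kappa>] q by simp
      from abs_integral_mult_scaled_product_le[OF q _ _ _ this h, of "F 0 (u - t)" C z]
      show "(LBINT w. F 0 (u - t) w * (K ((fst w - z) / h) * K ((snd w - z) / h))) \<le> C2 * h powr (2 / q)"
        using C[of "u - t"] tu by (simp add: C2_def)
    qed simp
    also have "\<dots> = C2 * h powr (- (2 / p))"
    proof -
      have "2 / q = 2 - 2 / p" using p by (simp add: q_def field_simps)
      moreover have "h powr (2 - 2 / p) / h\<^sup>2 = h powr (- (2 / p))"
        using h by (simp add: powr_diff powr_minus powr_numeral field_simps)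
      ultimately show ?thesis by (simp flip: times_divide_eq_right)
    qed
    also have "\<dots> \<le> (C1 * \<kappa>\<^sup>2 + C2) * h powr (- (2 / p))"
      using C1 by (intro mult_right_mono) auto
    finally have "?cov \<le> (C1 * \<kappa>\<^sup>2 + C2) * min (h powr (- (2 / p))) (h powr (- 2) * real_of_int (u - t) powr (- v))"
      using mix by (simp add: min_def)
    then show "(LINT \<omega>|M. scaled_kernel K h (Z t \<omega> - z) * scaled_kernel K h (Z u \<omega> - z))
        - (LINT \<omega>|M. scaled_kernel K h (Z t \<omega> - z)) * (LINT \<omega>|M. scaled_kernel K h (Z u \<omega> - z))
      \<le> (C1 * \<kappa>\<^sup>2 + C2) * min (h powr (- (2 / p))) (h powr (- 2) * real_of_int (u - t) powr (- v))"
      by (simp add: g_def)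
  qed
qed

section \<open>Mean squared error at a fixed sample size\<close>
text \<open>A bound for every sample size and bandwidth, given any bound \<open>D * c h k\<close> for the covariances at
lag \<open>k\<close>. It is twice the squared bias plus twice the variance. In the variance each of the \<open>T\<close>
summands contributes its second moment, of order \<open>1 / h\<close> because \<open>f\<close> is bounded and \<open>K\<close> is square
integrable, and its covariances with the other summands.\<close>
lemma kernel_estimator_mse_le:
  fixes Z :: "int \<Rightarrow> 'w \<Rightarrow> real" and f K :: "real \<Rightarrow> real" and c :: "real \<Rightarrow> nat \<Rightarrow> real" and D s z :: real
  assumes M: "prob_space M" and Z[measurable]: "\<And>t. Z t \<in> borel_measurable M"
    and f: "\<And>x. 0 \<le> f x" "\<And>t. distributed M lborel (Z t) (\<lambda>x. ennreal (f x))"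
      "bounded (range f)" "f \<in> smooth_class s \<Delta>" "0 < s"
    and K: "kernel_of_order r K" "s \<le> real r" "bounded (range K)" "integrable lborel (\<lambda>u. (K u)\<^sup>2)"
    and c: "0 \<le> D" "\<And>h k. 0 \<le> c h k"
    and cov: "\<And>h t u. 0 < h \<Longrightarrow> t < u \<Longrightarrow>
      (LINT \<omega>|M. scaled_kernel K h (Z t \<omega> - z) * scaled_kernel K h (Z u \<omega> - z))
        - (LINT \<omega>|M. scaled_kernel K h (Z t \<omega> - z)) * (LINT \<omega>|M. scaled_kernel K h (Z u \<omega> - z))
      \<le> D * c h (nat (u - t))"
  obtains E where "0 \<le> E"
    "\<And>b T. 0 < T \<Longrightarrow> 0 < b T \<Longrightarrow>
      (LINT \<omega>|M. \<bar>kernel_estimator K b Z T z \<omega> - f z\<bar>\<^sup>2)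
        \<le> E * (b T powr (2 * s) + (1 / b T + (\<Sum>k=1..T. c (b T) k)) / real T)"
proof -
  interpret prob_space M by fact
  have K1: "integrable lborel K"
    using K(1) by (auto simp: kernel_of_order_def has_bochner_integral_iff)
  then have [measurable]: "K \<in> borel_measurable borel" using borel_measurable_integrable by fastforce
  have mf[measurable]: "f \<in> borel_measurable borel"
    using distributed_real_measurable[OF _ f(2)[of 0]] f(1) by simp
  obtain \<kappa> where \<kappa>: "\<And>x. \<bar>K x\<bar> \<le> \<kappa>" using K(3) by (auto simp: bounded_iff)
  obtain B where B: "\<And>x. \<bar>f x\<bar> \<le> B" using f(3) by (auto simp: bounded_iff)
  have B0: "0 \<le> B" using B[of 0] by linarith
  obtain C where C: "0 \<le> C"
    "\<And>h. 0 < h \<Longrightarrow> \<bar>(LBINT x. f x * scaled_kernel K h (x - z)) - f z\<bar> \<le> C * h powr s"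
    by (rule kernel_bias_le[OF f(4,5,3) mf K(1,2), of z]) (rule that)
  define N where "N = (LBINT u. (K u)\<^sup>2)"
  have "0 \<le> N" by (simp add: N_def)
  define E where "E = 2 * C\<^sup>2 + 2 * (B * N) + 4 * D"
  show ?thesis
  proof (rule that[of E])
    show "0 \<le> E" using B0 \<open>0 \<le> N\<close> c by (simp add: E_def)
    fix b :: "nat \<Rightarrow> real" and T :: nat
    assume T: "0 < T" and bT: "0 < b T"
    define h where "h = b T"
    have h: "0 < h" using bT by (simp add: h_def)
    define g where "g x = scaled_kernel K h (x - z)" for x
    have g[measurable]: "g \<in> borel_measurable borel" unfolding g_def scaled_kernel_def by measurable
    have bg: "\<bar>g x\<bar> \<le> \<kappa> / h" for x
      using \<kappa> h by (simp add: g_def scaled_kernel_def abs_divide divide_right_mono)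
    define \<mu> where "\<mu> = (LBINT x. f x * g x)"
    have mean: "(LINT \<omega>|M. g (Z i \<omega>)) = \<mu>" for i
      using distributed_integral[OF f(2), of g i] f(1) by (simp add: \<mu>_def)
    have ig: "integrable M (\<lambda>\<omega>. g (Z i \<omega>))" for i
      using bg by (intro integrable_const_bound[where B="\<kappa> / h"]) auto
    have igg: "integrable M (\<lambda>\<omega>. g (Z i \<omega>) * g (Z j \<omega>))" for i j
      using bg by (intro integrable_const_bound[where B="(\<kappa> / h) * (\<kappa> / h)"])
        (auto simp: abs_mult simp del: times_divide_eq_left times_divide_eq_right intro!: mult_mono order_trans[OF abs_ge_zero])
    define Y where "Y t \<omega> = g (Z (int t) \<omega>) - \<mu>" for t \<omega>
    have YY: "Y t \<omega> * Y u \<omega> = g (Z (int t) \<omega>) * g (Z (int u) \<omega>) - \<mu> * g (Z (int t) \<omega>) - \<mu> * g (Z (int u) \<omega>) + \<mu>\<^sup>2" for t u \<omega>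
      by (simp add: Y_def algebra_simps power2_eq_square)
    have iYY: "integrable M (\<lambda>\<omega>. Y t \<omega> * Y u \<omega>)" for t u
      unfolding YY using ig igg by auto
    have EYY: "(LINT \<omega>|M. Y t \<omega> * Y u \<omega>) = (LINT \<omega>|M. g (Z (int t) \<omega>) * g (Z (int u) \<omega>)) - \<mu>\<^sup>2" for t u
      unfolding YY using ig igg by (simp add: mean prob_space power2_eq_square)
    have diag: "(LINT \<omega>|M. (Y t \<omega>)\<^sup>2) \<le> B * N / h" for t
    proof -
      have sq: "has_bochner_integral lborel (\<lambda>x. (g x)\<^sup>2) (N / h)"
      proof -
        have "has_bochner_integral lborel (\<lambda>u. (K u)\<^sup>2 / h\<^sup>2) (N / h\<^sup>2)"
          using K(4) by (simp add: has_bochner_integral_iff N_def)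
        then show ?thesis
          using lborel_has_bochner_integral_real_affine_iff[of "1 / h" "\<lambda>u. (K u)\<^sup>2 / h\<^sup>2" "N / h\<^sup>2" "- z / h"] h
          by (simp add: diff_divide_distrib divideR_right g_def scaled_kernel_def power_divide power2_eq_square)
      qed
      have "(LINT \<omega>|M. (Y t \<omega>)\<^sup>2) \<le> (LINT \<omega>|M. (g (Z (int t) \<omega>))\<^sup>2)"
        using EYY[of t t] by (simp add: power2_eq_square)
      also have "\<dots> = (LBINT x. f x * (g x)\<^sup>2)"
        using distributed_integral[OF f(2), of "\<lambda>x. (g x)\<^sup>2" "int t"] f(1) by simp
      also have "\<dots> \<le> (LBINT x. B * (g x)\<^sup>2)"
      proof (rule integral_mono)
        show iB: "integrable lborel (\<lambda>x. B * (g x)\<^sup>2)" using sq by (simp add: has_bochner_integral_iff)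
        show le: "f x * (g x)\<^sup>2 \<le> B * (g x)\<^sup>2" for x
          using B[of x] by (intro mult_right_mono) auto
        show "integrable lborel (\<lambda>x. f x * (g x)\<^sup>2)"
          using le f(1) B0 by (intro Bochner_Integration.integrable_bound[OF iB]) auto
      qed
      also have "\<dots> = B * N / h" using sq by (simp add: has_bochner_integral_iff)
      finally show ?thesis .
    qed
    have off: "(LINT \<omega>|M. Y t \<omega> * Y u \<omega>) \<le> D * c h (u - t)" if "t < u" for t u
    proof -
      have "(LINT \<omega>|M. g (Z (int t) \<omega>) * g (Z (int u) \<omega>)) - \<mu> * \<mu> \<le> D * c h (u - t)"
        using cov[OF h, of "int t" "int u"] that
        by (simp add: g_def[symmetric] mean nat_diff_distrib)
      then show ?thesis by (simp add: EYY power2_eq_square)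
    qed
    have var: "(LINT \<omega>|M. (\<Sum>t=1..T. Y t \<omega>)\<^sup>2) \<le> real T * (B * N / h + 2 * (\<Sum>k=1..T. D * c h k))"
      using iYY diag off c by (intro integral_square_sum_le) auto
    have est: "kernel_estimator K b Z T z \<omega> - f z = (\<Sum>t=1..T. Y t \<omega>) / real T + (\<mu> - f z)" for \<omega>
      using T by (simp add: kernel_estimator_def Y_def g_def h_def sum_subtractf diff_divide_distrib)
    have iS: "integrable M (\<lambda>\<omega>. (\<Sum>t=1..T. Y t \<omega>)\<^sup>2)"
      unfolding power2_eq_square sum_product using iYY by auto
    have "(LINT \<omega>|M. \<bar>kernel_estimator K b Z T z \<omega> - f z\<bar>\<^sup>2)
      \<le> (LINT \<omega>|M. 2 / (real T)\<^sup>2 * (\<Sum>t=1..T. Y t \<omega>)\<^sup>2 + 2 * (\<mu> - f z)\<^sup>2)"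
    proof (rule integral_mono_AE')
      show "integrable M (\<lambda>\<omega>. 2 / (real T)\<^sup>2 * (\<Sum>t=1..T. Y t \<omega>)\<^sup>2 + 2 * (\<mu> - f z)\<^sup>2)"
        using iS by simp
      have "(x + y)\<^sup>2 \<le> 2 * x\<^sup>2 + 2 * y\<^sup>2" for x y :: real
        using zero_le_power2[of "x - y"] by (simp add: power2_eq_square algebra_simps)
      from this[of "(\<Sum>t=1..T. Y t \<omega>) / real T" "\<mu> - f z" for \<omega>]
      show "AE \<omega> in M. \<bar>kernel_estimator K b Z T z \<omega> - f z\<bar>\<^sup>2
          \<le> 2 / (real T)\<^sup>2 * (\<Sum>t=1..T. Y t \<omega>)\<^sup>2 + 2 * (\<mu> - f z)\<^sup>2"
        unfolding est by (simp add: power_divide)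
    qed simp
    also have "\<dots> = 2 / (real T)\<^sup>2 * (LINT \<omega>|M. (\<Sum>t=1..T. Y t \<omega>)\<^sup>2) + 2 * (\<mu> - f z)\<^sup>2"
      using iS by (simp add: prob_space)
    also have "\<dots> \<le> 2 / (real T)\<^sup>2 * (real T * (B * N / h + 2 * (\<Sum>k=1..T. D * c h k))) + 2 * (C * h powr s)\<^sup>2"
    proof (intro add_mono mult_left_mono var)
      show "(\<mu> - f z)\<^sup>2 \<le> (C * h powr s)\<^sup>2"
        using C(2)[OF h] C(1) by (simp add: \<mu>_def g_def abs_le_square_iff[symmetric])
    qed auto
    also have "\<dots> = 2 * C\<^sup>2 * h powr (2 * s) + (2 * (B * N)) * (1 / h / real T) + 4 * D * ((\<Sum>k=1..T. c h k) / real T)"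
    proof -
      have "(h powr s)\<^sup>2 = h powr (2 * s)" using h by (simp add: powr_power mult.commute)
      then show ?thesis using T
        by (simp add: sum_distrib_left[symmetric] power_mult_distrib power2_eq_square field_simps)
    qed
    also have "\<dots> \<le> E * h powr (2 * s) + E * (1 / h / real T) + E * ((\<Sum>k=1..T. c h k) / real T)"
      using h T c B0 \<open>0 \<le> N\<close> unfolding E_def
      by (intro add_mono mult_right_mono divide_nonneg_nonneg sum_nonneg) auto
    also have "\<dots> = E * (h powr (2 * s) + (1 / h + (\<Sum>k=1..T. c h k)) / real T)"
      by (simp add: distrib_left add_divide_distrib)
    finally show "(LINT \<omega>|M. \<bar>kernel_estimator K b Z T z \<omega> - f z\<bar>\<^sup>2)
        \<le> E * (b T powr (2 * s) + (1 / b T + (\<Sum>k=1..T. c (b T) k)) / real T)"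
      by (simp add: h_def)
  qed
qed

section \<open>Rates\<close>
text \<open>As \<open>b\<close> is bounded on both sides by multiples of a power of \<open>T\<close>, its powers with positive and with
negative exponent are treated alike.\<close>
lemma bandwidth_powr_bigo:
  fixes b :: "nat \<Rightarrow> real"
  assumes b: "b \<in> \<Theta>(\<lambda>T. real T powr (- \<beta>))" "\<And>T. 0 < T \<Longrightarrow> 0 < b T" and le: "a - \<beta> * e \<le> \<rho>"
  shows "(\<lambda>T. b T powr e * real T powr a) \<in> O(\<lambda>T. real T powr \<rho>)"
proof -
  have "eventually (\<lambda>T. b T powr e * real T powr a = \<bar>b T\<bar> powr e * real T powr a) at_top"
    using eventually_gt_at_top[of 0] by eventually_elim (simp add: b(2) abs_of_pos)
  moreover have "(\<lambda>T. \<bar>b T\<bar> powr e * real T powr a) \<in> O(\<lambda>T. (real T powr (- \<beta>)) powr e * real T powr a)"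
    using bigtheta_powr[OF b(1), of e] by (intro landau_o.big.mult bigthetaD1) auto
  ultimately have "(\<lambda>T. b T powr e * real T powr a) \<in> O(\<lambda>T. (real T powr (- \<beta>)) powr e * real T powr a)"
    by (rule landau_o.big.in_cong[THEN iffD2])
  also have "(\<lambda>T. (real T powr (- \<beta>)) powr e * real T powr a) = (\<lambda>T. real T powr (a - \<beta> * e))"
    by (auto simp: powr_powr simp flip: powr_add)
  also have "(\<lambda>T. real T powr (a - \<beta> * e)) \<in> O(\<lambda>T. real T powr \<rho>)"
  proof (rule bigoI[of _ 1])
    show "eventually (\<lambda>T. norm (real T powr (a - \<beta> * e)) \<le> 1 * norm (real T powr \<rho>)) at_top"
      using eventually_ge_at_top[of 1] by eventually_elim (use le in \<open>auto intro: powr_mono\<close>)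
  qed
  finally show ?thesis .
qed

lemma bigo_mult_left:
  fixes f :: "nat \<Rightarrow> real"
  shows "f \<in> O(g) \<Longrightarrow> (\<lambda>T. c * f T) \<in> O(g)"
  by (cases "c = 0") auto

text \<open>Writing the order of the bandwidth \<open>b\<close> as \<open>T powr (- \<beta>)\<close>, the identity says that the covariance term
\<open>b powr (- 2) * T powr (- v)\<close> is exactly of the order \<open>b powr (2 * s)\<close> of the squared bias.\<close>
lemma rate_exponent_of_lt_one:
  fixes v q s :: real
  assumes "v < 1" "0 < q" "0 < s"
  shows "rate_exponent v q s / (2 * s + 1) * (2 * s + 2) = v"
proof -
  have "\<not> v > 1 + 1 / q" using assms by (simp add: not_less add_increasing2 less_imp_le)
  moreover have "2 * s + 1 \<noteq> 0" "2 * s + 2 \<noteq> 0" using assms by linarith+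
  ultimately show ?thesis using assms by (simp add: rate_exponent_def)
qed

text \<open>For a bandwidth \<open>b\<close> of order \<open>T powr (- \<beta>)\<close> the inequalities say that \<open>1 / (T b)\<close> and \<open>b powr (- (2 + q (1 - v))) / T\<close>, the two terms of
the variance, do not exceed the order \<open>b powr (2 * s)\<close> of the squared bias. The threshold
\<open>v = 1 + 1 / q\<close> is where \<open>2 + q (1 - v) = 1\<close>, that is, where the two terms exchange dominance.\<close>
lemma rate_exponent_of_gt_one:
  fixes v q s :: real
  assumes "1 < v" "0 < q" "0 < s"
  defines "\<beta> \<equiv> rate_exponent v q s / (2 * s + 1)"
  shows "\<beta> * (2 * s + 1) \<le> 1" "\<beta> * (2 * s + (2 + q * (1 - v))) \<le> 1"
proof -
  have s: "0 < 2 * s + 1" using assms by simp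
  show "\<beta> * (2 * s + 1) \<le> 1" "\<beta> * (2 * s + (2 + q * (1 - v))) \<le> 1"
  proof (atomize (full), cases "v > 1 + 1 / q")
    case True
    then have "1 + q * (1 - v) \<le> 0" using assms by (simp add: field_simps)
    moreover have \<beta>: "\<beta> = 1 / (2 * s + 1)" using True by (simp add: \<beta>_def rate_exponent_def)
    ultimately have "\<beta> * (2 * s + (2 + q * (1 - v))) \<le> \<beta> * (2 * s + 1)"
      using s by (intro mult_left_mono) auto
    moreover have "\<beta> * (2 * s + 1) = 1" using \<beta> s by simp
    ultimately show "\<beta> * (2 * s + 1) \<le> 1 \<and> \<beta> * (2 * s + (2 + q * (1 - v))) \<le> 1"
      by simp
  next
    case False
    then have "0 \<le> 1 + q * (1 - v)" using assms by (simp add: field_simps)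
    moreover from this have pos: "0 < 2 * s + (2 + q * (1 - v))" using assms by linarith
    moreover have "\<beta> = 1 / (2 * s + (2 + q * (1 - v)))"
      using False assms s by (simp add: \<beta>_def rate_exponent_def)
    ultimately show "\<beta> * (2 * s + 1) \<le> 1 \<and> \<beta> * (2 * s + (2 + q * (1 - v))) \<le> 1"
      by (simp add: divide_le_eq)
  qed
qed

text \<open>For \<open>v < 1\<close> the mixing branch of the minimum is used at every lag. For \<open>v > 1\<close> the sum is cut at
\<open>x = b powr (- q)\<close>: the lags below \<open>x\<close> then contribute \<open>x * b powr (q - 1) = 1 / b\<close>, the same as the
variances of the single summands, and the lags above it \<open>b powr (- (2 + q (1 - v)))\<close>.\<close>
lemma rate_of_mse_bound:
  fixes b R :: "nat \<Rightarrow> real" and v q s :: real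
  defines "\<beta> \<equiv> rate_exponent v q s / (2 * s + 1)"
  assumes v: "v \<noteq> 1" and q: "0 < q" and s: "0 < s"
    and b: "b \<in> \<Theta>(\<lambda>T. real T powr (- \<beta>))" "\<And>T. 0 < T \<Longrightarrow> 0 < b T"
    and R0: "\<And>T. 0 \<le> R T" and E: "0 \<le> E"
    and R: "\<And>T. 0 < T \<Longrightarrow> R T \<le> E * (b T powr (2 * s) +
      (1 / b T + (\<Sum>k=1..T. min (b T powr (q - 1)) (b T powr (- 2) * real k powr (- v)))) / real T)"
  shows "R \<in> O(\<lambda>T. real T powr (- (2 * s * \<beta>)))"
proof -
  let ?O = "O(\<lambda>T. real T powr (- (2 * s * \<beta>)))"
  let ?m = "\<lambda>T a e. b T powr e * real T powr a"
  note O = bandwidth_powr_bigo[OF b]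
  have bias: "(\<lambda>T. ?m T 0 (2 * s)) \<in> ?O" by (rule O) (auto simp: mult_ac)
  have "\<exists>G. G \<in> ?O \<and> (\<forall>T>0. R T \<le> G T)"
  proof (cases "v < 1")
    case True
    define A where "A = 2 powr \<bar>v\<bar> * 2 powr (1 - v) / (1 - v)"
    have \<beta>: "\<beta> * (2 * s + 2) = v" unfolding \<beta>_def by (rule rate_exponent_of_lt_one[OF True q s])
    then have \<beta>1: "\<beta> * (2 * s + 1) \<le> 1"
    proof (cases "0 \<le> \<beta>")
      case True
      then show ?thesis using \<beta> \<open>v < 1\<close> by (simp add: algebra_simps)
    next
      case False
      then show ?thesis using s mult_nonpos_nonneg[of \<beta> "2 * s + 1"] by simp
    qed
    let ?G = "\<lambda>T. E * (?m T 0 (2 * s) + ?m T (- 1) (- 1) + A * ?m T (- v) (- 2))"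
    have "R T \<le> ?G T" if T: "0 < T" for T
    proof -
      have bT: "0 < b T" using b(2) T .
      have "(\<Sum>k=1..T. min (b T powr (q - 1)) (b T powr (- 2) * real k powr (- v)))
          \<le> b T powr (- 2) * (\<Sum>k=1..T. real k powr (- v))"
        unfolding sum_distrib_left by (intro sum_mono) simp
      also have "\<dots> \<le> b T powr (- 2) * (A * real T powr (1 - v))"
        unfolding A_def using True T by (intro mult_left_mono sum_powr_le_of_lt_one) auto
      finally have "(1 / b T + (\<Sum>k=1..T. min (b T powr (q - 1)) (b T powr (- 2) * real k powr (- v)))) / real T
          \<le> (1 / b T + b T powr (- 2) * (A * real T powr (1 - v))) / real T"
        by (intro divide_right_mono add_left_mono) auto
      also have "\<dots> = ?m T (- 1) (- 1) + A * ?m T (- v) (- 2)"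
        using T bT by (simp add: add_divide_distrib powr_minus_divide powr_diff)
      finally have "E * (b T powr (2 * s) + (1 / b T + (\<Sum>k=1..T. min (b T powr (q - 1)) (b T powr (- 2) * real k powr (- v)))) / real T)
          \<le> E * (b T powr (2 * s) + (?m T (- 1) (- 1) + A * ?m T (- v) (- 2)))"
        using E by (intro mult_left_mono add_left_mono)
      note order_trans[OF R[OF T] this]
      also have "E * (b T powr (2 * s) + (?m T (- 1) (- 1) + A * ?m T (- v) (- 2))) = ?G T"
        using T by (simp add: add.assoc)
      finally show ?thesis .
    qed
    moreover have "?G \<in> ?O"
    proof (intro bigo_mult_left sum_in_bigo bias)
      show "(\<lambda>T. ?m T (- 1) (- 1)) \<in> ?O" 
      proof (rule O)
        show "- 1 - \<beta> * (- 1) \<le> - (2 * s * \<beta>)" using \<beta>1 by (simp add: distrib_left mult_ac)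
      qed
      show "(\<lambda>T. ?m T (- v) (- 2)) \<in> ?O" 
      proof (rule O)
        show "- v - \<beta> * (- 2) \<le> - (2 * s * \<beta>)" using \<beta> by (simp add: distrib_left mult_ac)
      qed
    qed
    ultimately show ?thesis by blast
  next
    case False
    then have v1: "1 < v" using v by simp
    note \<beta> = rate_exponent_of_gt_one[OF v1 q s, folded \<beta>_def]
    define A where "A = 2 powr v / (v - 1)"
    let ?e = "- (2 + q * (1 - v))"
    let ?G = "\<lambda>T. E * (?m T 0 (2 * s) + 2 * ?m T (- 1) (- 1) + A * ?m T (- 1) ?e)"
    have "R T \<le> ?G T" if T: "0 < T" for T
    proof -
      have bT: "0 < b T" using b(2) T .
      have "(\<Sum>k=1..T. min (b T powr (q - 1)) (b T powr (- 2) * real k powr (- v)))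
          \<le> b T powr (- q) * b T powr (q - 1) + A * (b T powr (- 2) * (b T powr (- q)) powr (1 - v))"
        unfolding A_def using v1 bT by (intro sum_min_powr_le_of_gt_one) auto
      also have "\<dots> = 1 / b T + A * b T powr ?e"
      proof -
        have "b T powr (- q) * b T powr (q - 1) = b T powr (- 1)"
          by (simp flip: powr_add)
        moreover have "b T powr (- 2) * (b T powr (- q)) powr (1 - v) = b T powr ?e"
          unfolding powr_powr powr_add[symmetric] by (simp add: algebra_simps)
        ultimately show ?thesis using bT by (simp only: powr_minus_divide powr_one)
      qed
      finally have "(1 / b T + (\<Sum>k=1..T. min (b T powr (q - 1)) (b T powr (- 2) * real k powr (- v)))) / real T
          \<le> (1 / b T + (1 / b T + A * b T powr ?e)) / real T"
        by (intro divide_right_mono add_left_mono) auto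
      also have "\<dots> = 2 * ?m T (- 1) (- 1) + A * ?m T (- 1) ?e"
        using T bT by (simp add: add_divide_distrib powr_minus_divide)
      finally have "E * (b T powr (2 * s) + (1 / b T + (\<Sum>k=1..T. min (b T powr (q - 1)) (b T powr (- 2) * real k powr (- v)))) / real T)
          \<le> E * (b T powr (2 * s) + (2 * ?m T (- 1) (- 1) + A * ?m T (- 1) ?e))"
        using E by (intro mult_left_mono add_left_mono)
      note order_trans[OF R[OF T] this]
      also have "E * (b T powr (2 * s) + (2 * ?m T (- 1) (- 1) + A * ?m T (- 1) ?e)) = ?G T"
        using T by (simp add: add.assoc)
      finally show ?thesis .
    qed
    moreover have "?G \<in> ?O"
    proof (intro bigo_mult_left sum_in_bigo bias)
      show "(\<lambda>T. ?m T (- 1) (- 1)) \<in> ?O" 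
      proof (rule O)
        show "- 1 - \<beta> * (- 1) \<le> - (2 * s * \<beta>)" using \<beta>(1) by (simp add: distrib_left mult_ac)
      qed
      show "(\<lambda>T. ?m T (- 1) ?e) \<in> ?O" 
      proof (rule O)
        have "\<beta> * (2 * s + (2 + q * (1 - v))) = 2 * s * \<beta> - \<beta> * ?e"
          by (simp add: algebra_simps)
        then show "- 1 - \<beta> * ?e \<le> - (2 * s * \<beta>)" using \<beta>(2) by linarith
      qed
    qed
    ultimately show ?thesis by blast
  qed
  then obtain G where G: "G \<in> ?O" "\<And>T. 0 < T \<Longrightarrow> R T \<le> G T" by blast
  have "R \<in> O(G)"
  proof (rule bigoI[of _ 1])
    show "eventually (\<lambda>T. norm (R T) \<le> 1 * norm (G T)) at_top"
      using eventually_gt_at_top[of 0]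
    proof eventually_elim
      case (elim T)
      show ?case using G(2)[OF elim] R0[of T] by simp
    qed
  qed
  then show ?thesis using G(1) by (rule landau_o.big_trans)
qed

theorem corollary3p3:
  fixes M :: "'w measure"
    and Z :: "int \<Rightarrow> 'w \<Rightarrow> real"
    and f K :: "real \<Rightarrow> real"
    and f2 :: "int \<Rightarrow> int \<Rightarrow> real \<times> real \<Rightarrow> real"
    and F :: "int \<Rightarrow> int \<Rightarrow> real \<times> real \<Rightarrow> real"
    and v p\<^sub>F q\<^sub>F s \<Delta> \<gamma> :: real
    and r :: nat
    and b :: "nat \<Rightarrow> real"
  assumes "prob_space M"
    and "stationary_process M Z"
    and "two_mixing M Z v"
    and "v \<noteq> 1"
    and "\<And>x. 0 \<le> f x"
    and "\<And>t. distributed M lborel (Z t) (\<lambda>x. ennreal (f x))"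
    and "bounded (range f)"
    and "\<And>t u x. t \<noteq> u \<Longrightarrow> 0 \<le> f2 t u x"
    and "\<And>t u. t \<noteq> u \<Longrightarrow>
           distributed M lborel (\<lambda>\<omega>. (Z t \<omega>, Z u \<omega>)) (\<lambda>x. ennreal (f2 t u x))"
    and "\<And>t u x y. t \<noteq> u \<Longrightarrow> F t u (x, y) = f2 t u (x, y) - f x * f y"
    and "p\<^sub>F > 2"
    and "\<exists>C. \<forall>t. t \<noteq> 0 \<longrightarrow> F 0 t \<in> Lp_space lborel p\<^sub>F \<and> Lp_norm lborel p\<^sub>F (F 0 t) \<le> C"
    and "q\<^sub>F = 1 - 2 / p\<^sub>F"
    and "kernel_of_order r K"
    and "bounded (range K)"
    and "K \<in> Lp_space lborel 1"
    and "K \<in> Lp_space lborel 2"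
    and "s > 0"
    and "\<Delta> > 0"
    and "f \<in> smooth_class s \<Delta>"
    and "real r \<ge> s"
    and "\<gamma> = rate_exponent v q\<^sub>F s"
    and "\<And>T. T > 0 \<Longrightarrow> b T > 0"
    and "b \<in> \<Theta>(\<lambda>T. real T powr (- \<gamma> / (2 * s + 1)))"
  shows "\<forall>z. (\<lambda>T. prob_space.expectation M (\<lambda>\<omega>. \<bar>kernel_estimator K b Z T z \<omega> - f z\<bar>\<^sup>2))
           \<in> O(\<lambda>T. real T powr (- (2 * s / (2 * s + 1)) * \<gamma>))"
proof
  fix z
  note M = assms(1) and stat = assms(2) and f0 = assms(5) and fd = assms(6)
  have Z: "\<And>t. Z t \<in> borel_measurable M" using stat by (auto simp: stationary_process_def)
  have iK: "integrable lborel K" using assms(14) by (auto simp: kernel_of_order_def has_bochner_integral_iff)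
  have iK2: "integrable lborel (\<lambda>u. (K u)\<^sup>2)" using assms(17) by (simp add: Lp_space_def powr_numeral)
  have q: "0 < q\<^sub>F" "- (2 / p\<^sub>F) = q\<^sub>F - 1" using assms(11) by (simp_all add: assms(13))
  let ?c = "\<lambda>h k. min (h powr (q\<^sub>F - 1)) (h powr (- 2) * real k powr (- v))"
  let ?R = "\<lambda>T. prob_space.expectation M (\<lambda>\<omega>. \<bar>kernel_estimator K b Z T z \<omega> - f z\<bar>\<^sup>2)"
  obtain D where D: "0 \<le> D" "\<And>h t u. 0 < h \<Longrightarrow> t < u \<Longrightarrow>
      (LINT \<omega>|M. scaled_kernel K h (Z t \<omega> - z) * scaled_kernel K h (Z u \<omega> - z))
        - (LINT \<omega>|M. scaled_kernel K h (Z t \<omega> - z)) * (LINT \<omega>|M. scaled_kernel K h (Z u \<omega> - z))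
      \<le> D * min (h powr (- (2 / p\<^sub>F))) (h powr (- 2) * real_of_int (u - t) powr (- v))"
    by (rule kernel_covariance_le[OF M stat assms(3) f0 fd assms(8,9,10,11,12) iK assms(15), of z])
      (assumption | rule that)+
  have cov: "(LINT \<omega>|M. scaled_kernel K h (Z t \<omega> - z) * scaled_kernel K h (Z u \<omega> - z))
        - (LINT \<omega>|M. scaled_kernel K h (Z t \<omega> - z)) * (LINT \<omega>|M. scaled_kernel K h (Z u \<omega> - z))
      \<le> D * ?c h (nat (u - t))" if "0 < h" "t < u" for h t u
    using D(2)[OF that] that unfolding q(2) by simp
  have c0: "0 \<le> ?c h k" for h k by simp
  obtain E where E: "0 \<le> E" "\<And>b T. 0 < T \<Longrightarrow> 0 < b T \<Longrightarrow>
      (LINT \<omega>|M. \<bar>kernel_estimator K b Z T z \<omega> - f z\<bar>\<^sup>2)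
        \<le> E * (b T powr (2 * s) + (1 / b T + (\<Sum>k=1..T. ?c (b T) k)) / real T)"
    by (rule kernel_estimator_mse_le[OF M Z f0 fd assms(7,20,18,14,21,15) iK2 D(1), where c = ?c and z = z])
      (rule c0 cov that; assumption)+
  have "?R \<in> O(\<lambda>T. real T powr (- (2 * s * (rate_exponent v q\<^sub>F s / (2 * s + 1)))))"
  proof (rule rate_of_mse_bound[OF assms(4) q(1) assms(18) _ assms(23) _ E(1)])
    show "b \<in> \<Theta>(\<lambda>T. real T powr (- (rate_exponent v q\<^sub>F s / (2 * s + 1))))"
      using assms(24) by (simp add: assms(22))
  qed (use E(2) assms(23) in auto)
  then show "?R \<in> O(\<lambda>T. real T powr (- (2 * s / (2 * s + 1)) * \<gamma>))"
    by (simp add: assms(22))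
qed

end
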